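(* Let $d \ge 3$, let $\mathcal{P}$ be a family of absolutely continuous multivariate Pareto distributions in dimension $d$ that forms a pairwise interaction model (with common support $\mathcal{Y} = \mathcal{L} := [0,\infty)^d \setminus [0,1]^d$), and let $\mathcal{F}$ be the corresponding class of densities. Then $\mathcal{F} \subseteq \mathcal{F}^{\rm gen HR}$, where $$\mathcal{F}^{\rm gen HR} := \bigg\{ \mathbf{y} \mapsto \frac{1}{Z(\mu,\Theta)} \exp\Big\{ -\mu^\top (\log \mathbf{y}) - (\log\mathbf{y})^\top \Theta (\log\mathbf{y}) \Big\} : \mu \in \mathbb{R}^d,\ \Theta \in \mathcal{S}_{\mathbf 1}^{d\times d} \bigg\}$$ is a class of functions on $\mathcal{L}$ and $\mathcal{S}_{\mathbf 1}^{d\times d}$ is the set of real symmetric $d\times d$ matrices with zero row (and column) sums.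
   Context: Multivariate Pareto distributions. Let $\mathcal{L} := [0,\infty)^d \setminus [0,1]^d$. An absolutely continuous random vector $\mathbf{Y} = (Y_1,\dots,Y_d)$ with Lebesgue density $f$ has a multivariate Pareto distribution if: (MP1) it is supported on $\mathcal{L}$, i.e., $f(\mathbf{y}) = 0$ for $\mathbf{y} \notin \mathcal{L}$; (MP2) $f(t\mathbf{y}) = t^{-(d+1)} f(\mathbf{y})$ for $\mathbf{y} \in \mathcal{L}$ and $t \ge 1$; (MP3) the probabilities $P(Y_k > 1)$, $k \in \{1,\dots,d\}$, are equal to each other. Pairwise interaction models. Let $\mathcal{S}^{d\times d}$ be the space of real symmetric $d \times d$ matrices and let $q \in \mathbb{N}$, $q \geq 1$. A (possibly curved) exponential family of probability distributions supported on a common set $\mathcal{Y} \subseteq \mathbb{R}^d$ and indexed by a parameter space $\Omega \subseteq (\mathbb{R}^q)^d \times \mathcal{S}^{d\times d}$ is called a pairwise interaction model if: (PI1) it corresponds to a family $\mathcal{F}$ of Lebesgue densities on $\mathcal{Y}$ (zero outside $\mathcal{Y}$) $$\mathbf{y} \mapsto f_{\mu,\Theta}(\mathbf{y}) = \frac{1}{Z(\mu,\Theta)} \exp\Big\{ -\sum_{i=1}^d \mu_i^\top S_i(y_i) - \sum_{i=1}^d \sum_{j=1}^d \Theta_{ij} T_i(y_i) T_j(y_j) \Big\}, \quad (\mu,\Theta) \in \Omega,$$ for some measurable functions $S_i: \mathbb{R} \to \mathbb{R}^q$ and measurable, non-constant functions $T_i : \mathbb{R} \to \mathbb{R}$ (the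 same for all parameters), where $\mu = (\mu_1,\dots,\mu_d)$ with $\mu_i \in \mathbb{R}^q$ and $Z(\mu,\Theta) \in (0,\infty)$ is the normalizing constant; and (PI2) for every pair $(i,j)$, $i \ne j$, there exists at least one $(\mu,\Theta) \in \Omega$ such that $\Theta_{ij} \neq 0$. No regularity of $\Omega$ is assumed. Notation. $\log\mathbf{y} := (\log y_1,\dots,\log y_d)$. In the definition of $\mathcal{F}^{\rm gen HR}$, $Z(\mu,\Theta)$ is the normalizing constant (integral over $\mathcal{L}$ of the exponential) when this integral is finite, and an arbitrary positive constant, e.g. $1$, otherwise. Formulas involving $\log\mathbf{y}$ are understood for $\mathbf{y} \in \mathcal{L}$ with all coordinates positive (the remaining points form a Lebesgue null set), and the inclusion $\mathcal{F}\subseteq\mathcal{F}^{\rm gen HR}$ is understood with densities restricted to $\mathcal{L}$ and identified up to Lebesgue null sets. *)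

theory Defs
  imports "HOL-Probability.Probability"
begin

definition pareto_support :: "(real ^ 'd) set" where
  "pareto_support = {y. \<forall>i. 0 \<le> y $ i} - {y. \<forall>i. y $ i \<in> {0..1}}"

(* A distribution is a measure on the Borel sets of R^d.  The defining conditions are required
   of some version of its Lebesgue density, since a density is only determined up to null sets. *)
definition multivariate_pareto :: "(real ^ 'd) measure \<Rightarrow> bool" where
  "multivariate_pareto M \<longleftrightarrow>
     prob_space M \<and>
     (\<exists>f :: real ^ 'd \<Rightarrow> real.
        f \<in> borel_measurable borel \<and> (\<forall>y. 0 \<le> f y) \<and>
        M = density lborel (\<lambda>y. ennreal (f y)) \<and>
        (\<forall>y. y \<notin> pareto_support \<longrightarrow> f y = 0) \<and>
        (\<forall>y\<in>pareto_support. \<forall>t\<ge>1. f (t *\<^sub>R y) = f y / t ^ (CARD('d) + 1))) \<and>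
     (\<forall>k l. measure M {y. 1 < y $ k} = measure M {y. 1 < y $ l})"

definition symmetric_matrices :: "(real ^ 'd ^ 'd) set" where
  "symmetric_matrices = {\<Theta>. transpose \<Theta> = \<Theta>}"

definition pi_kernel ::
  "('d \<Rightarrow> real \<Rightarrow> real ^ 'q) \<Rightarrow> ('d \<Rightarrow> real \<Rightarrow> real) \<Rightarrow>
   (real ^ 'q) ^ 'd \<Rightarrow> real ^ 'd ^ 'd \<Rightarrow> real ^ 'd \<Rightarrow> real" where
  "pi_kernel S T \<mu> \<Theta> y =
     exp (- (\<Sum>i\<in>UNIV. \<mu> $ i \<bullet> S i (y $ i))
          - (\<Sum>i\<in>UNIV. \<Sum>j\<in>UNIV. \<Theta> $ i $ j * T i (y $ i) * T j (y $ j)))"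

definition pi_normalizer ::
  "(real ^ 'd) set \<Rightarrow> ('d \<Rightarrow> real \<Rightarrow> real ^ 'q) \<Rightarrow> ('d \<Rightarrow> real \<Rightarrow> real) \<Rightarrow>
   (real ^ 'q) ^ 'd \<Rightarrow> real ^ 'd ^ 'd \<Rightarrow> real" where
  "pi_normalizer Y S T \<mu> \<Theta> = set_lebesgue_integral lborel Y (pi_kernel S T \<mu> \<Theta>)"

definition pi_density ::
  "(real ^ 'd) set \<Rightarrow> ('d \<Rightarrow> real \<Rightarrow> real ^ 'q) \<Rightarrow> ('d \<Rightarrow> real \<Rightarrow> real) \<Rightarrow>
   (real ^ 'q) ^ 'd \<Rightarrow> real ^ 'd ^ 'd \<Rightarrow> real ^ 'd \<Rightarrow> real" where
  "pi_density Y S T \<mu> \<Theta> y =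
     (if y \<in> Y then 1 / pi_normalizer Y S T \<mu> \<Theta> * pi_kernel S T \<mu> \<Theta> y else 0)"

definition pi_densities ::
  "(real ^ 'd) set \<Rightarrow> (((real ^ 'q) ^ 'd) \<times> (real ^ 'd ^ 'd)) set \<Rightarrow>
   ('d \<Rightarrow> real \<Rightarrow> real ^ 'q) \<Rightarrow> ('d \<Rightarrow> real \<Rightarrow> real) \<Rightarrow> (real ^ 'd \<Rightarrow> real) set" where
  "pi_densities Y \<Omega> S T = {pi_density Y S T \<mu> \<Theta> | \<mu> \<Theta>. (\<mu>, \<Theta>) \<in> \<Omega>}"

(* Integrability is stated separately because the library integral of a non-integrable
   function is 0; together with positivity it says that the normalizer is in (0,oo). *)
definition pairwise_interaction_model ::
  "(real ^ 'd) set \<Rightarrow> (((real ^ 'q) ^ 'd) \<times> (real ^ 'd ^ 'd)) set \<Rightarrow>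
   ('d \<Rightarrow> real \<Rightarrow> real ^ 'q) \<Rightarrow> ('d \<Rightarrow> real \<Rightarrow> real) \<Rightarrow> (real ^ 'd) measure set \<Rightarrow> bool" where
  "pairwise_interaction_model Y \<Omega> S T \<P> \<longleftrightarrow>
     Y \<in> sets borel \<and>
     \<Omega> \<subseteq> UNIV \<times> symmetric_matrices \<and>
     (\<forall>i. S i \<in> borel_measurable borel) \<and>
     (\<forall>i. T i \<in> borel_measurable borel \<and> \<not> T i constant_on UNIV) \<and>
     (\<forall>(\<mu>, \<Theta>)\<in>\<Omega>. set_integrable lborel Y (pi_kernel S T \<mu> \<Theta>) \<and>
                  0 < pi_normalizer Y S T \<mu> \<Theta>) \<and>
     \<P> = (\<lambda>f. density lborel (\<lambda>y. ennreal (f y))) ` pi_densities Y \<Omega> S T \<and>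
     (\<forall>i j. i \<noteq> j \<longrightarrow> (\<exists>(\<mu>, \<Theta>)\<in>\<Omega>. \<Theta> $ i $ j \<noteq> 0))"

(* Only meaningful for positive coordinates; all other points of the support are a null set. *)
definition log_vec :: "real ^ 'd \<Rightarrow> real ^ 'd" where
  "log_vec y = (\<chi> i. ln (y $ i))"

definition gen_HR_kernel :: "real ^ 'd \<Rightarrow> real ^ 'd ^ 'd \<Rightarrow> real ^ 'd \<Rightarrow> real" where
  "gen_HR_kernel \<mu> \<Theta> y = exp (- (\<mu> \<bullet> log_vec y) - log_vec y \<bullet> (\<Theta> *v log_vec y))"

definition gen_HR_normalizer :: "real ^ 'd \<Rightarrow> real ^ 'd ^ 'd \<Rightarrow> real" where
  "gen_HR_normalizer \<mu> \<Theta> =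
     (if set_integrable lborel pareto_support (gen_HR_kernel \<mu> \<Theta>)
      then set_lebesgue_integral lborel pareto_support (gen_HR_kernel \<mu> \<Theta>) else 1)"

definition zero_row_sum_symmetric_matrices :: "(real ^ 'd ^ 'd) set" where
  "zero_row_sum_symmetric_matrices =
     {\<Theta> \<in> symmetric_matrices. \<forall>i. (\<Sum>j\<in>UNIV. \<Theta> $ i $ j) = 0}"

(* The members are functions on the Pareto support; their values elsewhere are irrelevant. *)
definition gen_HR :: "(real ^ 'd \<Rightarrow> real) set" where
  "gen_HR = {\<lambda>y. 1 / gen_HR_normalizer \<mu> \<Theta> * gen_HR_kernel \<mu> \<Theta> y | \<mu> \<Theta>.
               \<Theta> \<in> zero_row_sum_symmetric_matrices}"

(* Inclusion of classes of functions, up to equality almost everywhere on the set A. *)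
definition ae_subclass_on ::
  "(real ^ 'd) set \<Rightarrow> (real ^ 'd \<Rightarrow> real) set \<Rightarrow> (real ^ 'd \<Rightarrow> real) set \<Rightarrow> bool" where
  "ae_subclass_on A \<F> \<G> \<longleftrightarrow> (\<forall>f\<in>\<F>. \<exists>g\<in>\<G>. AE y in lborel. y \<in> A \<longrightarrow> f y = g y)"

end

theory Submission imports Defs begin

text \<open>
  Let \<open>E\<close> be the negative log-density. Homogeneity says that \<open>E (t y) - E y\<close> does not depend on
  \<open>y\<close>. If some \<open>T i\<close> were a.e. constant on the positive reals, the density would factor into a
  function of \<open>y i\<close> and a function of the other coordinates; doubling \<open>y i\<close> would then multiply it
  by a constant, which contradicts integrability over \<open>0 < y i\<close>. For \<open>i \<noteq> j\<close> the mixed second difference of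
  \<open>E\<close> in \<open>y i\<close> and \<open>y j\<close> (a third coordinate above 1 keeps all points in the support) gives
  \<open>T i (t s) = c i t * T i s + const\<close> with \<open>c i t * c j t = 1\<close>. For \<open>d \<ge> 3\<close> this forces \<open>c = 1\<close>,
  so every \<open>T i\<close> is an affine function of \<open>ln\<close>. Choosing the diagonal so that the rows sum to zero
  makes the quadratic part scale invariant; the remainder of \<open>E\<close> is a sum of functions of single
  coordinates, and homogeneity makes each of these an affine function of \<open>ln\<close> as well.
\<close>

subsection \<open>Slices of Lebesgue-almost-everywhere statements\<close>

definition upd :: "real ^ 'd \<Rightarrow> 'd \<Rightarrow> real \<Rightarrow> real ^ 'd" where
  "upd z i s = (\<chi> j. if j = i then s else z $ j)"

lemma upd_nth [simp]: "upd z i s $ j = (if j = i then s else z $ j)"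
  by (simp add: upd_def)

text \<open>The points where \<open>P (f x)\<close> fails lie in the \<open>g\<close>-image of the
  exceptional set of \<open>P\<close>, because \<open>g\<close> undoes \<open>f\<close>; a linear
  \<open>g\<close> is differentiable and therefore maps negligible sets to negligible sets.\<close>

lemma AE_lborel_linear:
  fixes f g :: "'a::euclidean_space \<Rightarrow> 'a"
  assumes "linear g" and inv: "\<And>x. g (f x) = x" and "AE x in lborel. P x"
  shows "AE x in lborel. P (f x)"
proof -
  have "AE x in lebesgue. P x"
    using assms(3) by (rule AE_completion)
  then obtain N where N: "negligible N" "{x. \<not> P x} \<subseteq> N"
    unfolding eventually_ae_filter_negligible by blast
  have "negligible (g ` N)"
    using N(1) assms(1) by (intro negligible_differentiable_image_negligible)
      (auto intro: linear_imp_differentiable_on)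
  moreover have "{x. \<not> P (f x)} \<subseteq> g ` N"
  proof
    fix x assume "x \<in> {x. \<not> P (f x)}"
    then have "f x \<in> N" using N(2) by blast
    then show "x \<in> g ` N" using inv[of x] by (metis imageI)
  qed
  ultimately have "AE x in lebesgue. P (f x)"
    unfolding eventually_ae_filter_negligible by blast
  then show ?thesis
    by (simp add: AE_completion_iff)
qed

text \<open>Swapping coordinate \<open>i\<close> with the adjoined real is a linear involution, so
  it preserves null sets. This turns Fubini for the product with a line into Fubini along coordinate
  \<open>i\<close> of \<open>real ^ 'd\<close>.\<close>

lemma AE_lborel_exchange:
  fixes i :: "'d::finite"
  assumes "AE x in lborel \<Otimes>\<^sub>M lborel. Q (fst x) (snd x)"
  shows "AE x in lborel \<Otimes>\<^sub>M lborel. Q (upd (fst x) i (snd x)) (fst x $ i)"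
proof -
  let ?f = "\<lambda>x :: (real ^ 'd) \<times> real. (upd (fst x) i (snd x), fst x $ i)"
  have "linear ?f"
    by (rule linearI) (auto simp: vec_eq_iff)
  moreover have "?f (?f x) = x" for x
    by (auto simp: vec_eq_iff prod_eq_iff)
  moreover have "AE x in lborel. Q (fst x) (snd x)"
    using assms unfolding lborel_prod .
  ultimately have "AE x in lborel. Q (fst (?f x)) (snd (?f x))"
    by (rule AE_lborel_linear)
  then show ?thesis
    by (simp only: lborel_prod fst_conv snd_conv)
qed

lemma AE_prod_lborel:
  assumes "AE y in lborel. Q (y::'b::euclidean_space)"
  shows "AE x in (lborel :: 'a::euclidean_space measure) \<Otimes>\<^sub>M lborel. Q (snd x)"
    and "AE x in lborel \<Otimes>\<^sub>M (lborel :: 'a::euclidean_space measure). Q (fst x)"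
proof -
  \<comment> \<open>\<open>Q\<close> need not be measurable; avoiding a Borel null set
    \<open>N\<close> is a measurable condition that implies it.\<close>
  obtain N where N: "N \<in> null_sets lborel" "{y. \<not> Q y} \<subseteq> N"
    using assms by (auto simp: eventually_ae_filter)
  have [measurable]: "N \<in> sets borel"
    using N(1) by auto
  have "AE x in (lborel :: 'a measure) \<Otimes>\<^sub>M lborel. snd x \<notin> N"
  proof (rule lborel_pair.AE_pair_measure)
    show "{x \<in> space ((lborel :: 'a measure) \<Otimes>\<^sub>M lborel). snd x \<notin> N} \<in> sets (lborel \<Otimes>\<^sub>M lborel)"
      by measurable
  qed (use AE_not_in[OF N(1)] in auto)
  then show "AE x in (lborel :: 'a measure) \<Otimes>\<^sub>M lborel. Q (snd x)"
    using N(2) by (auto elim: eventually_mono)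
  have "AE x in lborel \<Otimes>\<^sub>M (lborel :: 'a measure). fst x \<notin> N"
  proof (rule lborel_pair.AE_pair_measure)
    show "{x \<in> space (lborel \<Otimes>\<^sub>M (lborel :: 'a measure)). fst x \<notin> N} \<in> sets (lborel \<Otimes>\<^sub>M lborel)"
      by measurable
  qed (use AE_not_in[OF N(1)] in auto)
  then show "AE x in lborel \<Otimes>\<^sub>M (lborel :: 'a measure). Q (fst x)"
    using N(2) by (auto elim: eventually_mono)
qed

lemma AE_lborel_obtain_Ioo:
  assumes "a < (b::real)" "AE s in lborel. a < s \<longrightarrow> s < b \<longrightarrow> P s"
  obtains s where "a < s" "s < b" "P s"
proof (rule ccontr)
  assume "\<not> thesis"
  then have "AE s in lborel. s \<notin> {a<..<b}"
    using assms(2) that by (auto elim: eventually_mono)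
  then have "emeasure lborel {a<..<b} = 0"
    by (subst (asm) AE_iff_measurable[of "{a<..<b}"]) auto
  then show False using assms(1) by simp
qed

text \<open>Adjoin a real on which \<open>Q\<close> does not depend, exchange it with coordinate
  \<open>i\<close>, and apply Fubini.\<close>

lemma AE_lborel_upd:
  assumes "AE z in lborel. Q (z :: real ^ 'd)"
  shows "AE z in lborel. AE s in lborel. Q (upd z i s)"
  using lborel_pair.AE_pair
    [OF AE_lborel_exchange[where Q = "\<lambda>z _. Q z", OF AE_prod_lborel(2)[OF assms]]]
  by simp

lemma AE_lborel_nth:
  fixes i :: "'d::finite"
  assumes "AE s in lborel. P (s :: real)"
  shows "AE z in lborel. P (z $ i)"
  using lborel_pair.AE_pair
    [OF AE_lborel_exchange[where Q = "\<lambda>_. P" and i = i, OF AE_prod_lborel(1)[OF assms]]]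
  \<comment> \<open>After the exchange the inner statement no longer mentions its variable, so a
    single witness in (0,1) discharges it.\<close>
  by (auto elim!: eventually_mono intro: AE_lborel_obtain_Ioo[of 0 1])

text \<open>The cube \<open>(1,2)^d\<close> has positive measure. Base points of slices are taken
  there: as long as one coordinate stays untouched, it exceeds 1 and keeps positive points inside
  the Pareto support.\<close>

lemma AE_lborel_vec_obtain:
  assumes "AE z in lborel. Q (z :: real ^ 'd)"
  obtains z where "\<forall>j. 1 < z $ j \<and> z $ j < 2" "Q z"
proof -
  let ?B = "box (\<chi> i. 1) (\<chi> i. 2) :: (real ^ 'd) set"
  have "\<exists>z \<in> ?B. Q z"
  proof (rule ccontr)
    assume "\<not> ?thesis"
    then have "AE s in lborel. s \<notin> ?B"
      using assms(1) by (auto elim: eventually_mono)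
    then have "emeasure lborel ?B = 0"
      by (subst (asm) AE_iff_measurable[of "?B"]) auto
    moreover have "0 < (\<Prod>b\<in>Basis. ((\<chi> i. 2) - (\<chi> i. 1) :: real ^ 'd) \<bullet> b)"
      by (rule prod_pos) (auto simp: Basis_vec_def inner_axis)
    ultimately show False
      by (subst (asm) emeasure_lborel_box) (auto simp: Basis_vec_def inner_axis)
  qed
  then obtain z where "\<forall>j. 1 < z $ j \<and> z $ j < 2" "Q z"
    unfolding Bex_def mem_box_cart vec_lambda_beta by blast
  then show ?thesis by (rule that)
qed

subsection \<open>Cauchy's equation almost everywhere\<close>

lemma AE_pos_scale:
  assumes "0 < (t::real)" "AE s in lborel. 0 < s \<longrightarrow> P s"
  shows "AE s in lborel. 0 < s \<longrightarrow> P (t * s)"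
proof -
  have "AE s in lborel. 0 < t * s \<longrightarrow> P (t * s)"
    by (rule AE_lborel_linear[of "\<lambda>s. s / t" "\<lambda>s. t * s" "\<lambda>s. 0 < s \<longrightarrow> P s"])
      (use assms in \<open>auto intro!: linearI simp: add_divide_distrib\<close>)
  then show ?thesis
    using assms(1) by (auto elim!: eventually_mono simp: zero_less_mult_iff)
qed

lemma AE_pos_obtain:
  assumes "AE s in lborel. 0 < (s::real) \<longrightarrow> P s"
  obtains s where "0 < s" "P s"
  by (rule AE_lborel_obtain_Ioo[of 0 1 "P"]) (use assms in \<open>auto elim: eventually_mono\<close>)

text \<open>The deviation \<open>D\<close> from the linear function that agrees with
  \<open>c\<close> at \<open>\<delta>\<close> is additive and vanishes at \<open>\<delta>\<close>.
  It is thus \<open>\<delta>\<close>-periodic and bounded everywhere, while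
  \<open>D (n x) = n D x\<close> would be unbounded unless \<open>D x = 0\<close>.\<close>

lemma additive_locally_bounded_imp_linear:
  fixes c :: "real \<Rightarrow> real"
  assumes add: "\<And>x y. 0 \<le> x \<Longrightarrow> 0 \<le> y \<Longrightarrow> c (x + y) = c x + c y"
    and "0 < \<delta>" and bound: "\<And>x. 0 \<le> x \<Longrightarrow> x \<le> \<delta> \<Longrightarrow> \<bar>c x\<bar> \<le> B"
    and "0 \<le> x"
  shows "c x = c \<delta> / \<delta> * x"
proof -
  define D where "D x = c x - c \<delta> / \<delta> * x" for x
  have D_add: "D (x + y) = D x + D y" if "0 \<le> x" "0 \<le> y" for x y
    using that by (simp add: D_def add algebra_simps add_divide_distrib)
  have D_mult: "D (real n * x) = real n * D x" if "0 \<le> x" for n x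
  proof (induction n)
    case 0
    show ?case using D_add[of 0 0] by simp
  next
    case (Suc n)
    then show ?case using that D_add[of "x" "real n * x"] by (simp add: algebra_simps)
  qed
  have "D \<delta> = 0"
    using \<open>0 < \<delta>\<close> by (simp add: D_def)
  define K where "K = B + \<bar>c \<delta>\<bar>"
  have D_small: "\<bar>D x\<bar> \<le> K" if "0 \<le> x" "x \<le> \<delta>" for x
  proof -
    have "\<bar>c \<delta> / \<delta> * x\<bar> = \<bar>c \<delta>\<bar> * (x / \<delta>)"
      using that \<open>0 < \<delta>\<close> by (simp add: abs_mult)
    also have "\<dots> \<le> \<bar>c \<delta>\<bar> * 1"
      using that \<open>0 < \<delta>\<close> by (intro mult_left_mono) auto
    finally show ?thesis using bound[OF that] unfolding D_def K_def by linarith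
  qed
  have D_bound: "\<bar>D x\<bar> \<le> K" if "0 \<le> x" for x
  proof -
    define n where "n = nat \<lfloor>x / \<delta>\<rfloor>"
    have n: "real n \<le> x / \<delta>" "x / \<delta> < real n + 1"
      using that \<open>0 < \<delta>\<close> by (auto simp: n_def)
    then have r: "0 \<le> x - real n * \<delta>" "x - real n * \<delta> \<le> \<delta>"
      using \<open>0 < \<delta>\<close> by (auto simp: field_simps)
    have "D x = D (x - real n * \<delta>) + D (real n * \<delta>)"
      using D_add[OF r(1), of "real n * \<delta>"] \<open>0 < \<delta>\<close> by simp
    then show ?thesis
      using D_small[OF r] D_mult[of \<delta> n] \<open>0 < \<delta>\<close> \<open>D \<delta> = 0\<close> by simp
  qed
  have "D x = 0"
  proof (rule ccontr)
    assume "D x \<noteq> 0"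
    then obtain n where "K < real n * \<bar>D x\<bar>"
      using reals_Archimedean3[of "\<bar>D x\<bar>"] by auto
    then show False
      using D_bound[of "real n * x"] D_mult[of x n] \<open>0 \<le> x\<close> by (simp add: abs_mult)
  qed
  then show ?thesis by (simp add: D_def)
qed

text \<open>The exceptional set in \<open>s\<close> depends on \<open>t\<close>. Fubini exchanges
  the two quantifiers and yields one fixed \<open>s\<close> with
  \<open>\<psi> (t * s) = \<psi> s\<close> for almost all positive \<open>t\<close>; as
  \<open>t\<close> varies, \<open>t * s\<close> covers almost all of the positive reals.\<close>

lemma AE_scale_invariant_imp_const:
  fixes \<psi> :: "real \<Rightarrow> real"
  assumes [measurable]: "\<psi> \<in> borel_measurable borel"
    and inv: "\<And>t. 1 \<le> t \<Longrightarrow> AE s in lborel. 0 < s \<longrightarrow> \<psi> (t * s) = \<psi> s"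
  obtains \<kappa> where "AE s in lborel. 0 < s \<longrightarrow> \<psi> s = \<kappa>"
proof -
  have inv': "AE s in lborel. 0 < s \<longrightarrow> \<psi> (t * s) = \<psi> s" if "0 < t" for t
  proof (cases "1 \<le> t")
    case False
    have "AE s in lborel. 0 < s \<longrightarrow> \<psi> (inverse t * s) = \<psi> s"
      using False that by (intro inv) (auto simp: field_simps)
    from AE_pos_scale[OF that this] show ?thesis
      using that by (auto elim!: eventually_mono simp: field_simps)
  qed (rule inv)
  have "AE t in lborel. AE s in lborel. 0 < t \<longrightarrow> 0 < s \<longrightarrow> \<psi> (t * s) = \<psi> s"
    using inv' by auto
  then have "AE s in lborel. AE t in lborel. 0 < t \<longrightarrow> 0 < s \<longrightarrow> \<psi> (t * s) = \<psi> s"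
    by (subst (asm) lborel_pair.AE_commute) measurable
  then have "AE s in lborel. 0 < s \<longrightarrow> (AE t in lborel. 0 < t \<longrightarrow> \<psi> (t * s) = \<psi> s)"
    by (auto elim: eventually_mono)
  then obtain s where s: "0 < s" "AE t in lborel. 0 < t \<longrightarrow> \<psi> (t * s) = \<psi> s"
    by (rule AE_pos_obtain)
  have "AE t in lborel. 0 < t \<longrightarrow> \<psi> (inverse s * t * s) = \<psi> s"
    using AE_pos_scale[OF _ s(2), of "inverse s"] s(1) by simp
  then have "AE t in lborel. 0 < t \<longrightarrow> \<psi> t = \<psi> s"
    using s(1) by (simp add: field_simps)
  then show thesis by (rule that)
qed

text \<open>A measurable function is bounded on a set filling more than three quarters of \<open>{1..2}\<close>; this
  set meets its rescalings by factors near 1, which bounds \<open>c\<close> near 1.\<close>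

lemma AE_scale_increment_bounded:
  fixes \<phi> c :: "real \<Rightarrow> real"
  assumes [measurable]: "\<phi> \<in> borel_measurable borel"
    and c: "\<And>t. 1 \<le> t \<Longrightarrow> AE s in lborel. 0 < s \<longrightarrow> \<phi> (t * s) = \<phi> s + c t"
  obtains B where "\<And>t. 1 \<le> t \<Longrightarrow> t \<le> 5 / 4 \<Longrightarrow> \<bar>c t\<bar> \<le> B"
proof -
  define A where "A n = {s \<in> {1..2}. \<bar>\<phi> s\<bar> \<le> real n}" for n
  have A_sets [measurable]: "A n \<in> sets borel" for n
    unfolding A_def by measurable
  have A_fm: "A n \<in> fmeasurable lborel" for n
    by (rule fmeasurableI2[of "{1..2}"])
      (auto simp: A_def emeasure_lborel_Icc_eq intro!: fmeasurableI)
  have "(\<lambda>n. measure lborel (A n)) \<longlonglongrightarrow> measure lborel (\<Union>n. A n)"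
  proof (rule Lim_measure_incseq)
    show "incseq A" by (auto simp: A_def incseq_def)
    have "emeasure lborel (\<Union>n. A n) \<le> emeasure lborel {1..2::real}"
      by (rule emeasure_mono) (auto simp: A_def)
    then show "emeasure lborel (\<Union>n. A n) \<noteq> \<infinity>"
      by (auto simp: top_unique)
  qed auto
  moreover have "(\<Union>n. A n) = {1..2}"
    using real_arch_simple by (fastforce simp: A_def)
  ultimately have "(\<lambda>n. measure lborel (A n)) \<longlonglongrightarrow> 1"
    by simp
  then have "eventually (\<lambda>n. measure lborel (A n) > 3 / 4) sequentially"
    by (rule order_tendstoD) simp
  then obtain n where n: "measure lborel (A n) > 3 / 4"
    by (auto simp: eventually_sequentially)
  have "\<bar>c t\<bar> \<le> 2 * real n" if t: "1 \<le> t" "t \<le> 5 / 4" for t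
  proof (rule ccontr)
    assume *: "\<not> ?thesis"
    define A' where "A' = (\<lambda>s. t * s) -` A n"
    have "(\<lambda>s. t * s) \<in> borel \<rightarrow>\<^sub>M borel"
      by simp
    from measurable_sets[OF this A_sets[of n]] have [measurable]: "A' \<in> sets borel"
      by (simp only: A'_def space_borel Int_UNIV_right)
    have "emeasure lborel (A n) = \<bar>t\<bar> * emeasure lborel A'"
    proof -
      have "emeasure lborel (A n) = (\<integral>\<^sup>+ s. indicator (A n) s \<partial>lborel)" by simp
      also have "\<dots> = \<bar>t\<bar> * (\<integral>\<^sup>+ s. indicator (A n) (0 + t * s) \<partial>lborel)"
        using t by (intro nn_integral_real_affine) auto
      also have "(\<lambda>s. indicator (A n) (0 + t * s) :: ennreal) = indicator A'"
        by (auto simp: A'_def indicator_def)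
      finally show ?thesis by simp
    qed
    then have meas: "measure lborel (A n) = t * measure lborel A'"
      using t by (simp add: measure_def enn2real_mult)
    have sub: "A n \<union> A' \<subseteq> {1/t..2}"
    proof -
      have "1 / t \<le> s \<and> s \<le> 2" if "1 \<le> t * s" "t * s \<le> 2" for s
      proof -
        have "0 < t * s" using that by linarith
        then have "0 < s" using t by (simp add: zero_less_mult_iff)
        then have "s \<le> t * s" using t by simp
        with that t show ?thesis by (auto simp: field_simps)
      qed
      moreover have "1 / t \<le> s" if "1 \<le> s" for s
      proof -
        have "1 / t \<le> 1" using t by simp
        then show ?thesis using that by linarith
      qed
      ultimately show ?thesis by (auto simp: A_def A'_def)
    qed
    have Icc_fm: "{1/t..2} \<in> fmeasurable lborel"
      by (rule fmeasurableI) (auto simp: emeasure_lborel_Icc_eq)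
    then have A'_fm: "A' \<in> fmeasurable lborel"
      by (rule fmeasurableI2) (use sub in auto)
    \<comment> \<open>On the intersection both \<open>\<phi> s\<close> and
      \<open>\<phi> (t * s)\<close> are bounded by \<open>n\<close>, so outside a null set their
      difference \<open>c t\<close> would be at most \<open>2 * n\<close> in absolute value,
      contrary to the assumption.\<close>
    have "AE s in lborel. s \<notin> A n \<inter> A'"
      using c[OF t(1)]
    proof (rule eventually_mono)
      fix s assume s: "0 < s \<longrightarrow> \<phi> (t * s) = \<phi> s + c t"
      show "s \<notin> A n \<inter> A'"
        using s * by (auto simp: A_def A'_def)
    qed
    then have "emeasure lborel (A n \<inter> A') = 0"
      by (subst (asm) AE_iff_measurable[of "A n \<inter> A'"]) auto
    then have "measure lborel (A n \<inter> A') = 0"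
      by (simp add: measure_def)
    then have "measure lborel (A n) + measure lborel A' = measure lborel (A n \<union> A')"
      using measure_Un3[OF A_fm A'_fm, of n] by simp
    also have "\<dots> \<le> measure lborel {1/t..2}"
      by (rule measure_mono_fmeasurable[OF sub _ Icc_fm]) auto
    also have "\<dots> = 2 - 1 / t"
      using t by (subst measure_lborel_Icc) (auto simp: field_simps)
    finally have "measure lborel (A n) + measure lborel (A n) / t \<le> 2 - 1 / t"
      using meas t by simp
    then have "t * (measure lborel (A n) + measure lborel (A n) / t) \<le> t * (2 - 1 / t)"
      using t by (intro mult_left_mono) auto
    then have "measure lborel (A n) * (t + 1) \<le> 2 * t - 1"
      using t by (simp add: distrib_left distrib_right right_diff_distrib mult.commute)
    \<comment> \<open>The two bounds give \<open>3 / 4 * (t + 1) < 2 * t - 1\<close>, that is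
      \<open>t > 7 / 5\<close>, which \<open>t \<le> 5 / 4\<close> excludes.\<close>
    moreover have "3 / 4 * (t + 1) < measure lborel (A n) * (t + 1)"
      using n t by (intro mult_strict_right_mono) auto
    ultimately show False using t by (simp add: field_simps)
  qed
  then show thesis by (rule that)
qed

text \<open>The increments satisfy \<open>c (t * u) = c t + c u\<close>, so \<open>c\<close>
  composed with \<open>exp\<close> is additive on the nonnegative reals. Being bounded near 0 it is
  linear with some slope \<open>\<alpha>\<close>, and \<open>\<phi> - \<alpha> * ln\<close> is then
  scale invariant, hence constant almost everywhere.\<close>

lemma AE_scale_increment_imp_affine_ln:
  fixes \<phi> :: "real \<Rightarrow> real"
  assumes [measurable]: "\<phi> \<in> borel_measurable borel"
    and ex: "\<And>t. 1 \<le> t \<Longrightarrow> \<exists>c. AE s in lborel. 0 < s \<longrightarrow> \<phi> (t * s) = \<phi> s + c"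
  obtains \<alpha> \<beta> where "AE s in lborel. 0 < s \<longrightarrow> \<phi> s = \<alpha> * ln s + \<beta>"
proof -
  obtain c where c: "\<And>t. 1 \<le> t \<Longrightarrow> AE s in lborel. 0 < s \<longrightarrow> \<phi> (t * s) = \<phi> s + c t"
    using ex by metis
  have mult: "c (t * u) = c t + c u" if "1 \<le> t" "1 \<le> u" for t u
  proof -
    have tu: "1 \<le> t * u" using that by (metis mult_mono' mult_1 zero_le_one)
    have "AE s in lborel. 0 < s \<longrightarrow> \<phi> (t * (u * s)) = \<phi> (u * s) + c t"
      using that c AE_pos_scale[of u "\<lambda>s. \<phi> (t * s) = \<phi> s + c t"] by simp
    then have "AE s in lborel. 0 < (s::real) \<longrightarrow> c (t * u) = c t + c u"
      using c[OF tu] c[OF that(2)] by eventually_elim (auto simp: mult.assoc)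
    then show ?thesis by (rule AE_pos_obtain)
  qed
  obtain B where B: "\<And>t. 1 \<le> t \<Longrightarrow> t \<le> 5 / 4 \<Longrightarrow> \<bar>c t\<bar> \<le> B"
    using AE_scale_increment_bounded[OF assms(1) c] by blast
  define \<alpha> where "\<alpha> = c (exp (ln (5 / 4))) / ln (5 / 4)"
  have exp_le: "exp x \<le> 5 / 4" if "x \<le> ln (5 / 4)" for x :: real
  proof -
    have "exp x \<le> exp (ln (5 / 4))" using that by (subst exp_le_cancel_iff)
    then show ?thesis by simp
  qed
  have "c (exp x) = \<alpha> * x" if "0 \<le> x" for x
    unfolding \<alpha>_def
    by (rule additive_locally_bounded_imp_linear[where c = "\<lambda>x. c (exp x)" and B = B])
      (use that exp_le in \<open>auto simp: exp_add mult B\<close>)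
  then have c_ln: "c t = \<alpha> * ln t" if "1 \<le> t" for t
    using that by (metis exp_ln ln_ge_zero order_less_le_trans zero_less_one)
  have "AE s in lborel. 0 < s \<longrightarrow> \<phi> (t * s) - \<alpha> * ln (t * s) = \<phi> s - \<alpha> * ln s" if "1 \<le> t" for t
    using c[OF that]
    by eventually_elim (use that in \<open>auto simp: c_ln ln_mult algebra_simps\<close>)
  then obtain \<kappa> where "AE s in lborel. 0 < s \<longrightarrow> \<phi> s - \<alpha> * ln s = \<kappa>"
    using AE_scale_invariant_imp_const[of "\<lambda>s. \<phi> s - \<alpha> * ln s"] by auto
  then show thesis
    by (intro that[of \<alpha> \<kappa>]) (auto elim: eventually_mono)
qed

subsection \<open>Increments of products\<close>

text \<open>A function that is not constant on the whole line may still have this property, since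
  its values may differ only at nonpositive points or on a null set. That no \<open>T i\<close> has
  it is derived from the integrability of the densities.\<close>

definition AE_pos_const :: "(real \<Rightarrow> real) \<Rightarrow> bool" where
  "AE_pos_const p \<longleftrightarrow> (\<exists>\<kappa>. AE s in lborel. 0 < s \<longrightarrow> p s = \<kappa>)"

lemma AE_pos_const_scaleD:
  assumes "0 < t" "AE_pos_const (\<lambda>s. p (t * s))"
  shows "AE_pos_const p"
proof -
  obtain \<kappa> where "AE s in lborel. 0 < s \<longrightarrow> p (t * s) = \<kappa>"
    using assms(2) unfolding AE_pos_const_def by blast
  from AE_pos_scale[of "inverse t", OF _ this] show ?thesis
    using assms(1) unfolding AE_pos_const_def by (auto simp: field_simps)
qed

lemma AE_pos_distinct_values:
  assumes "\<not> AE_pos_const q" "AE u in lborel. 0 < u \<longrightarrow> R u"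
  obtains u v where "0 < u" "0 < v" "R u" "R v" "q u \<noteq> q v"
proof (rule ccontr)
  note witness = that
  assume "\<not> thesis"
  then have eq: "q u = q v" if "0 < u" "0 < v" "R u" "R v" for u v
    using that witness by blast
  obtain v where v: "0 < v" "R v" using assms(2) by (rule AE_pos_obtain)
  have "AE u in lborel. 0 < u \<longrightarrow> q u = q v"
    using assms(2)
  proof (rule eventually_mono)
    fix u assume "0 < u \<longrightarrow> R u"
    with eq[OF _ v(1) _ v(2)] show "0 < u \<longrightarrow> q u = q v" by simp
  qed
  then show False using assms(1) unfolding AE_pos_const_def by blast
qed

lemma AE_pos_affine_unique:
  assumes "\<not> AE_pos_const p"
    and "AE s in lborel. 0 < s \<longrightarrow> f s = c * p s + e"
    and "AE s in lborel. 0 < s \<longrightarrow> f s = c' * p s + e'"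
  shows "c = c'"
proof -
  have "AE s in lborel. 0 < s \<longrightarrow> c * p s + e = c' * p s + e'"
    using assms(2,3) by eventually_elim auto
  from AE_pos_distinct_values[OF assms(1) this] obtain u v where
    uv: "c * p u + e = c' * p u + e'" "c * p v + e = c' * p v + e'" "p u \<noteq> p v"
    by metis
  then have "(c - c') * (p u - p v) = 0" by (simp add: algebra_simps)
  then show ?thesis using uv(3) by simp
qed

text \<open>Subtracting the equation at \<open>v\<close> from the one at \<open>u\<close> eliminates
  \<open>a s\<close> and leaves a relation that is linear in \<open>p (t * s)\<close> and
  \<open>p s\<close>. One pair with \<open>q (t * u) \<noteq> q (t * v)\<close> shows that
  \<open>p (t * s)\<close> is affine in \<open>p s\<close>; comparing slopes for all other pairs
  gives the reciprocal rate for \<open>q\<close>.\<close>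

lemma AE_product_increment_separable:
  fixes p q :: "real \<Rightarrow> real"
  assumes "0 < t" and p: "\<not> AE_pos_const p" and q: "\<not> AE_pos_const q"
    and eq: "AE u in lborel. AE s in lborel. 0 < u \<longrightarrow> 0 < s \<longrightarrow>
               p (t * s) * q (t * u) - p s * q u = a s + b u"
  obtains c e e' where "c \<noteq> 0" "AE s in lborel. 0 < s \<longrightarrow> p (t * s) = c * p s + e"
    "AE u in lborel. 0 < u \<longrightarrow> q (t * u) = inverse c * q u + e'"
proof -
  define good where "good u \<longleftrightarrow>
    (AE s in lborel. 0 < s \<longrightarrow> p (t * s) * q (t * u) - p s * q u = a s + b u)" for u
  have good: "AE u in lborel. 0 < u \<longrightarrow> good u"
    using eq unfolding good_def by (auto elim!: eventually_mono)
  have diff: "AE s in lborel. 0 < s \<longrightarrow>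
      p (t * s) * (q (t * u) - q (t * v)) = (q u - q v) * p s + (b u - b v)"
    if "good u" "good v" for u v
    using that unfolding good_def
    by eventually_elim (auto simp: algebra_simps)
  obtain u0 v0 where uv0: "good u0" "good v0" "q (t * u0) \<noteq> q (t * v0)"
    using AE_pos_distinct_values[of "\<lambda>u. q (t * u)", OF _ good] AE_pos_const_scaleD[OF \<open>0 < t\<close>] q
    by metis
  define c where "c = (q u0 - q v0) / (q (t * u0) - q (t * v0))"
  define e where "e = (b u0 - b v0) / (q (t * u0) - q (t * v0))"
  have pc: "AE s in lborel. 0 < s \<longrightarrow> p (t * s) = c * p s + e"
    using diff[OF uv0(1,2)]
  proof eventually_elim
    case (elim s)
    show ?case
    proof
      assume "0 < s"
      with elim uv0(3) have "p (t * s) =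
          ((q u0 - q v0) * p s + (b u0 - b v0)) / (q (t * u0) - q (t * v0))"
        by (simp add: eq_divide_eq)
      then show "p (t * s) = c * p s + e"
        by (simp add: c_def e_def add_divide_distrib)
    qed
  qed
  \<comment> \<open>Two affine expressions in \<open>p s\<close> for the same function must have
    equal slopes because \<open>p\<close> is not almost everywhere constant.\<close>
  have qc: "c * (q (t * u) - q (t * v)) = q u - q v" if "good u" "good v" for u v
  proof (rule AE_pos_affine_unique[OF p])
    let ?f = "\<lambda>s. p (t * s) * (q (t * u) - q (t * v))"
    show "AE s in lborel. 0 < s \<longrightarrow> ?f s =
        (c * (q (t * u) - q (t * v))) * p s + e * (q (t * u) - q (t * v))"
      using pc by eventually_elim (auto simp: algebra_simps)
    show "AE s in lborel. 0 < s \<longrightarrow> ?f s = (q u - q v) * p s + (b u - b v)"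
      by (rule diff[OF that])
  qed
  have "c \<noteq> 0"
  proof
    assume "c = 0"
    obtain u v where "good u" "good v" "q u \<noteq> q v"
      using AE_pos_distinct_values[OF q good] by metis
    then show False using qc[of u v] \<open>c = 0\<close> by simp
  qed
  have "AE u in lborel. 0 < u \<longrightarrow> q (t * u) = inverse c * q u + (q (t * v0) - inverse c * q v0)"
    using good
  proof eventually_elim
    case (elim u)
    show ?case
    proof
      assume "0 < u"
      with elim have "c * (q (t * u) - q (t * v0)) = q u - q v0"
        using qc uv0(2) by simp
      then show "q (t * u) = inverse c * q u + (q (t * v0) - inverse c * q v0)"
        using \<open>c \<noteq> 0\<close> by (simp add: field_simps)
    qed
  qed
  with \<open>c \<noteq> 0\<close> pc show thesis by (rule that)
qed

lemma third_index:
  assumes "CARD('d::finite) \<ge> 3"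
  shows "\<exists>k :: 'd. k \<noteq> i \<and> k \<noteq> j"
proof (rule ccontr)
  assume "\<not> ?thesis"
  then have "(UNIV :: 'd set) \<subseteq> {i, j}" by auto
  then have "CARD('d) \<le> card {i, j}" by (intro card_mono) auto
  also have "\<dots> \<le> 2" by (simp add: card_insert_if)
  finally show False using assms by simp
qed

text \<open>With three indices the rates satisfy \<open>c i * c j = c j * c k = c k * c i = 1\<close>, so each of
  them is 1 or -1; the rate at \<open>t\<close> is the square of the rate at \<open>sqrt t\<close>, hence 1.\<close>

lemma AE_scale_rates_trivial:
  fixes T :: "'d::finite \<Rightarrow> real \<Rightarrow> real"
  assumes card: "CARD('d) \<ge> 3" and T: "\<And>i. \<not> AE_pos_const (T i)"
    and pair: "\<And>i j t. i \<noteq> j \<Longrightarrow> 1 \<le> t \<Longrightarrow> \<exists>c e e'. c \<noteq> 0 \<and>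
       (AE s in lborel. 0 < s \<longrightarrow> T i (t * s) = c * T i s + e) \<and>
       (AE s in lborel. 0 < s \<longrightarrow> T j (t * s) = inverse c * T j s + e')"
    and "1 \<le> t"
  shows "\<exists>e. AE s in lborel. 0 < s \<longrightarrow> T i (t * s) = T i s + e"
proof -
  define R where "R i t c \<longleftrightarrow> (\<exists>e. AE s in lborel. 0 < s \<longrightarrow> T i (t * s) = c * T i s + e)" for i t c
  have unique: "c = c'" if R: "R i t c" "R i t c'" for i t c c'
  proof -
    obtain e e' where "AE s in lborel. 0 < s \<longrightarrow> T i (t * s) = c * T i s + e"
      "AE s in lborel. 0 < s \<longrightarrow> T i (t * s) = c' * T i s + e'"
      using R unfolding R_def by blast
    then show ?thesis by (rule AE_pos_affine_unique[OF T])
  qed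
  have pairR: "\<exists>c. c \<noteq> 0 \<and> R i t c \<and> R j t (inverse c)" if "i \<noteq> j" "1 \<le> t" for i j t
    using pair[OF that] unfolding R_def by blast
  obtain j k where j: "j \<noteq> i" and k: "k \<noteq> i" "k \<noteq> j"
    using third_index[OF card] by metis
  define r where "r = sqrt t"
  have r: "1 \<le> r" "r * r = t" using \<open>1 \<le> t\<close> by (auto simp: r_def)
  obtain c where c: "c \<noteq> 0" "R i r c" "R j r (inverse c)" using pairR[of i j r] j r by auto
  obtain c' where c': "c' \<noteq> 0" "R j r c'" "R k r (inverse c')" using pairR[of j k r] k r by auto
  obtain c'' where c'': "c'' \<noteq> 0" "R k r c''" "R i r (inverse c'')" using pairR[of k i r] k r by auto
  \<comment> \<open>Uniqueness of the rates at \<open>j\<close>, \<open>k\<close> and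
    \<open>i\<close> gives \<open>c' = 1/c\<close>, then \<open>c'' = 1/c' = c\<close>, and finally
    \<open>c = 1/c'' = 1/c\<close>.\<close>
  have "c = inverse c"
    using unique[OF c(3) c'(2)] unique[OF c'(3) c''(2)] unique[OF c(2) c''(3)] by simp
  then have c1: "c * c = 1" using c(1) by (metis right_inverse)
  obtain e where e: "AE s in lborel. 0 < s \<longrightarrow> T i (r * s) = c * T i s + e"
    using c(2) unfolding R_def by blast
  have "AE s in lborel. 0 < s \<longrightarrow> T i (r * (r * s)) = c * T i (r * s) + e"
    using AE_pos_scale[OF _ e, of r] r by simp
  with e have "AE s in lborel. 0 < s \<longrightarrow> T i (t * s) = T i s + (c * e + e)"
  proof eventually_elim
    case (elim s)
    show ?case
    proof
      assume "0 < s"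
      then have "T i (t * s) = (c * c) * T i s + (c * e + e)"
        using elim by (simp add: r(2)[symmetric] algebra_simps)
      then show "T i (t * s) = T i s + (c * e + e)" by (simp add: c1)
    qed
  qed
  then show ?thesis by blast
qed

section \<open>Rescaling a single coordinate\<close>

text \<open>Change of variables for a diagonal map with entry \<open>c\<close> in direction
  \<open>i\<close> and 1 elsewhere, whose Jacobian is \<open>c\<close>.\<close>

lemma nn_integral_upd_scale:
  fixes f :: "real ^ 'd \<Rightarrow> ennreal"
  assumes [measurable]: "f \<in> borel_measurable borel" and "0 < c"
  shows "(\<integral>\<^sup>+ y. f y \<partial>lborel) = ennreal c * (\<integral>\<^sup>+ y. f (upd y i (c * y $ i)) \<partial>lborel)"
proof -
  let ?c = "\<lambda>j :: real ^ 'd. if j = axis i 1 then c else 1"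
  let ?T = "\<lambda>x :: real ^ 'd. 0 + (\<Sum>j\<in>Basis. (?c j * (x \<bullet> j)) *\<^sub>R j)"
  have T: "?T x = upd x i (c * x $ i)" for x
  proof -
    have "?T x \<bullet> b = upd x i (c * x $ i) \<bullet> b" if b: "b \<in> Basis" for b
    proof -
      have "?T x \<bullet> b = ?c b * (x \<bullet> b)"
        using b by (simp add: inner_sum_left inner_Basis if_distrib[of "\<lambda>z. _ * z"] sum.delta' cong: if_cong)
      then show ?thesis
        using b by (auto simp: Basis_vec_def inner_axis axis_eq_axis)
    qed
    then show ?thesis by (rule euclidean_eqI)
  qed
  have "(\<Prod>j\<in>(Basis :: (real ^ 'd) set). \<bar>?c j\<bar>) = (\<Prod>j\<in>(Basis :: (real ^ 'd) set). if j = axis i 1 then c else 1)"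
    using \<open>0 < c\<close> by (intro prod.cong) auto
  also have "\<dots> = c"
    by (subst prod.delta) (auto simp: Basis_vec_def)
  finally have prod: "(\<Prod>j\<in>(Basis :: (real ^ 'd) set). \<bar>?c j\<bar>) = c" .
  have [measurable]: "?T \<in> borel \<rightarrow>\<^sub>M borel" by simp
  have "(lborel :: (real ^ 'd) measure) =
      density (distr lborel borel ?T) (\<lambda>_. \<Prod>j\<in>(Basis :: (real ^ 'd) set). \<bar>?c j\<bar>)"
    using \<open>0 < c\<close> by (intro lborel_affine_euclidean) auto
  then have "(\<integral>\<^sup>+ y. f y \<partial>lborel) = (\<integral>\<^sup>+ y. f y \<partial>density (distr lborel borel ?T) (\<lambda>_. c))"
    unfolding prod by simp
  also have "\<dots> = ennreal c * (\<integral>\<^sup>+ y. f (?T y) \<partial>lborel)"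
    by (subst nn_integral_density) (auto simp: nn_integral_cmult nn_integral_distr)
  finally show ?thesis unfolding T .
qed

text \<open>Let \<open>M\<close> have density \<open>k\<close>. Doubling coordinate \<open>i\<close>
  maps \<open>U\<close> onto itself and multiplies masses by \<open>2 * r\<close>. The slab
  \<open>1 < y $ i \<le> 2\<close> has positive mass: comparing the parts of \<open>U\<close> above
  2 and above 1 forces \<open>2 * r < 1\<close>, while comparing those up to 2 and up to 1 forces
  \<open>2 * r > 1\<close>.\<close>

lemma scale_quasi_invariant_not_integrable:
  fixes k :: "real ^ 'd \<Rightarrow> real" and i :: 'd
  defines "U \<equiv> {y. 0 < y $ i \<and> (\<forall>j. j \<noteq> i \<longrightarrow> 1 < y $ j)}"
  assumes [measurable]: "k \<in> borel_measurable borel" and pos: "\<And>y. 0 < k y"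
    and fin: "(\<integral>\<^sup>+ y. ennreal (k y) * indicator U y \<partial>lborel) < \<infinity>"
    and scale: "AE y in lborel. y \<in> U \<longrightarrow> k (upd y i (2 * y $ i)) = r * k y"
  shows False
proof -
  define M where "M = density lborel (\<lambda>y. ennreal (k y))"
  have sets_M [simp]: "sets M = sets borel" by (simp add: M_def)
  have [measurable]: "U \<in> sets borel" unfolding U_def by measurable
  have M: "emeasure M W = (\<integral>\<^sup>+ y. ennreal (k y) * indicator W y \<partial>lborel)"
    if "W \<in> sets borel" for W
    using that by (simp add: M_def emeasure_density)
  have fin_W: "emeasure M W \<noteq> \<top>" if "W \<subseteq> U" for W
    using emeasure_mono[of W U M] fin that by (auto simp: M[of U] top_unique)
  \<comment> \<open>One point that obeys the scaling relation exhibits \<open>r\<close> as a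
    quotient of positive values of \<open>k\<close>.\<close>
  obtain y where "\<forall>j. 1 < y $ j \<and> y $ j < 2" "y \<in> U \<longrightarrow> k (upd y i (2 * y $ i)) = r * k y"
    using scale by (rule AE_lborel_vec_obtain)
  moreover have U_I: "y \<in> U" if "\<And>j. 1 < y $ j" for y
    using that less_trans[OF zero_less_one that] by (simp add: U_def)
  ultimately have "0 < r * k y"
    using pos by metis
  then have "0 < r"
    using pos[of y] by (simp add: zero_less_mult_iff)
  have I: "measure M W = 2 * r * measure M W'"
    if [measurable]: "W \<in> sets borel" "W' \<in> sets borel" and sub: "W' \<subseteq> U"
      and W': "\<And>y. upd y i (2 * y $ i) \<in> W \<longleftrightarrow> y \<in> W'" for W W'
  proof -
    have "continuous_on UNIV (\<lambda>y :: real ^ 'd. if j = i then 2 * y $ i else y $ j)" for j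
      by (cases "j = i") (auto intro!: continuous_intros)
    then have [measurable]: "(\<lambda>y :: real ^ 'd. upd y i (2 * y $ i)) \<in> borel \<rightarrow>\<^sub>M borel"
      unfolding upd_def by (intro borel_measurable_continuous_onI continuous_on_vec_lambda)
    have "emeasure M W = ennreal 2 * (\<integral>\<^sup>+ y. ennreal (k (upd y i (2 * y $ i))) *
        indicator W (upd y i (2 * y $ i)) \<partial>lborel)"
      by (subst M, simp, subst nn_integral_upd_scale[where i = i and c = 2]) auto
    also have "(\<integral>\<^sup>+ y. ennreal (k (upd y i (2 * y $ i))) * indicator W (upd y i (2 * y $ i)) \<partial>lborel) =
        (\<integral>\<^sup>+ y. ennreal r * (ennreal (k y) * indicator W' y) \<partial>lborel)"
    proof (rule nn_integral_cong_AE, use scale in eventually_elim)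
      case (elim y)
      then show ?case
        using sub \<open>0 < r\<close> pos[of y]
        by (auto simp: indicator_def W' ennreal_mult)
    qed
    also have "\<dots> = ennreal r * emeasure M W'"
      by (subst nn_integral_cmult) (auto simp: M)
    finally show ?thesis
      using \<open>0 < r\<close> by (simp add: measure_def enn2real_mult)
  qed
  let ?hi = "\<lambda>a. {y \<in> U. a < y $ i}" and ?lo = "\<lambda>a. {y \<in> U. y $ i \<le> a}"
  let ?B = "{y \<in> U. 1 < y $ i \<and> y $ i \<le> 2}"
  have hi: "measure M (?hi 2) = 2 * r * measure M (?hi 1)"
    by (rule I) (auto simp: U_def)
  have lo: "measure M (?lo 2) = 2 * r * measure M (?lo 1)"
    by (rule I) (auto simp: U_def split: if_splits)
  have "?hi 1 = ?hi 2 \<union> ?B" by auto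
  then have hi': "measure M (?hi 1) = measure M (?hi 2) + measure M ?B"
    by (subst measure_Union[symmetric]) (auto simp: fin_W)
  have "?lo 2 = ?lo 1 \<union> ?B" by auto
  then have lo': "measure M (?lo 2) = measure M (?lo 1) + measure M ?B"
    by (subst measure_Union[symmetric]) (auto simp: fin_W)
  have "emeasure M ?B \<noteq> 0"
  proof
    assume "emeasure M ?B = 0"
    then have "AE y in lborel. ennreal (k y) * indicator ?B y = 0"
      by (subst (asm) M, simp, subst (asm) nn_integral_0_iff_AE) auto
    moreover have "ennreal (k y) \<noteq> 0" for y
      using pos[of y] by simp
    ultimately have "AE y in lborel. y \<notin> ?B"
      by (auto elim!: eventually_mono simp: indicator_def split: if_splits)
    then obtain z where z: "\<forall>j. 1 < z $ j \<and> z $ j < 2" "z \<notin> ?B"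
      by (rule AE_lborel_vec_obtain)
    have "z \<in> ?B"
      using U_I[of z] z(1) by (simp add: less_imp_le)
    with z(2) show False ..
  qed
  moreover have "emeasure M ?B = ennreal (measure M ?B)"
    by (rule emeasure_eq_ennreal_measure, rule fin_W) auto
  ultimately have B: "0 < measure M ?B"
    by (cases "measure M ?B = 0") (auto simp: zero_less_measure_iff)
  show False
  proof (cases "2 * r \<ge> 1")
    case True
    have "1 * measure M (?hi 1) \<le> 2 * r * measure M (?hi 1)"
      using True by (intro mult_right_mono) auto
    then show False using hi hi' B by linarith
  next
    case False
    have "2 * r * measure M (?lo 1) \<le> 1 * measure M (?lo 1)"
      using False by (intro mult_right_mono) auto
    then show False using lo lo' B by linarith
  qed
qed

subsection \<open>Homogeneous pair energies\<close>

text \<open>The exponent of the interaction density, with the linear terms \<open>\<mu> $ i \<bullet> S i s\<close> merged into \<open>h i s\<close>.\<close>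

definition pair_energy :: "('d \<Rightarrow> real \<Rightarrow> real) \<Rightarrow> ('d \<Rightarrow> real \<Rightarrow> real) \<Rightarrow> real ^ 'd ^ 'd \<Rightarrow> real ^ 'd \<Rightarrow> real" where
  "pair_energy h T \<Theta> y =
     (\<Sum>i\<in>UNIV. h i (y $ i)) + (\<chi> i. T i (y $ i)) \<bullet> (\<Theta> *v (\<chi> i. T i (y $ i)))"

lemma quadratic_form_sum:
  fixes \<Theta> :: "real ^ 'd ^ 'd"
  shows "v \<bullet> (\<Theta> *v v) = (\<Sum>i\<in>UNIV. \<Sum>j\<in>UNIV. \<Theta> $ i $ j * v $ i * v $ j)"
  by (simp add: inner_vec_def matrix_vector_mult_def sum_distrib_left mult_ac)

lemma pi_kernel_energy:
  "pi_kernel S T \<mu> \<Theta> y = exp (- pair_energy (\<lambda>i s. \<mu> $ i \<bullet> S i s) T \<Theta> y)"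
  by (simp add: pi_kernel_def pair_energy_def quadratic_form_sum)

lemma symmetric_matrices_inner:
  assumes "\<Theta> \<in> symmetric_matrices"
  shows "x \<bullet> (\<Theta> *v y) = (\<Theta> *v x) \<bullet> y"
proof -
  have "transpose \<Theta> = \<Theta>"
    using assms by (simp add: symmetric_matrices_def)
  then show ?thesis
    by (metis dot_lmul_matrix transpose_matrix_vector)
qed

text \<open>The vector of the \<open>T k\<close> splits into a part \<open>v\<close> free of
  \<open>s\<close> and \<open>u\<close> plus multiples of the basis vectors for \<open>i\<close> and
  \<open>j\<close>. In the expanded quadratic form only the cross term involves both variables, and
  symmetry counts it twice.\<close>

lemma pair_energy_upd:
  assumes "\<Theta> \<in> symmetric_matrices" "i \<noteq> j"
  obtains A B where
    "\<forall>s u. pair_energy h T \<Theta> (upd (upd z j u) i s) = A s + B u + 2 * \<Theta> $ i $ j * (T i s * T j u)"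
proof -
  define v where "v = (\<chi> k. if k = i \<or> k = j then 0 else T k (z $ k))"
  define H where "H = (\<Sum>k\<in>UNIV - {i, j}. h k (z $ k))"
  let ?e = "\<lambda>k. axis k 1 :: real ^ 'a"
  define A where "A s = h i s + 2 * T i s * (?e i \<bullet> (\<Theta> *v v)) + (T i s)\<^sup>2 * (?e i \<bullet> (\<Theta> *v ?e i))" for s
  define B where "B u = H + v \<bullet> (\<Theta> *v v) + h j u + 2 * T j u * (?e j \<bullet> (\<Theta> *v v)) +
      (T j u)\<^sup>2 * (?e j \<bullet> (\<Theta> *v ?e j))" for u
  have "pair_energy h T \<Theta> (upd (upd z j u) i s) = A s + B u + 2 * \<Theta> $ i $ j * (T i s * T j u)" for s u
  proof -
    let ?y = "upd (upd z j u) i s"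
    have "(\<chi> k. T k (?y $ k)) = v + T i s *\<^sub>R ?e i + T j u *\<^sub>R ?e j"
      using \<open>i \<noteq> j\<close> by (auto simp: vec_eq_iff v_def axis_def)
    moreover have "(\<Sum>k\<in>UNIV. h k (?y $ k)) = H + h i s + h j u"
    proof -
      have "(\<Sum>k\<in>UNIV. h k (?y $ k)) = (\<Sum>k\<in>UNIV - {i, j}. h k (?y $ k)) + (\<Sum>k\<in>{i, j}. h k (?y $ k))"
        by (subst sum.subset_diff[of "{i, j}"]) auto
      also have "(\<Sum>k\<in>UNIV - {i, j}. h k (?y $ k)) = H"
        unfolding H_def by (rule sum.cong) auto
      finally show ?thesis using \<open>i \<noteq> j\<close> by simp
    qed
    moreover have "(v + a *\<^sub>R ?e i + b *\<^sub>R ?e j) \<bullet> (\<Theta> *v (v + a *\<^sub>R ?e i + b *\<^sub>R ?e j)) =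
        v \<bullet> (\<Theta> *v v) + 2 * a * (?e i \<bullet> (\<Theta> *v v)) + a\<^sup>2 * (?e i \<bullet> (\<Theta> *v ?e i)) +
        2 * b * (?e j \<bullet> (\<Theta> *v v)) + b\<^sup>2 * (?e j \<bullet> (\<Theta> *v ?e j)) + 2 * \<Theta> $ i $ j * (a * b)" for a b
    proof -
      have "?e i \<bullet> (\<Theta> *v ?e j) = \<Theta> $ i $ j"
        by (simp add: matrix_vector_mult_basis inner_axis' column_def)
      moreover have "?e j \<bullet> (\<Theta> *v ?e i) = ?e i \<bullet> (\<Theta> *v ?e j)"
        "v \<bullet> (\<Theta> *v ?e i) = ?e i \<bullet> (\<Theta> *v v)" "v \<bullet> (\<Theta> *v ?e j) = ?e j \<bullet> (\<Theta> *v v)"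
        by (subst symmetric_matrices_inner[OF assms(1)], rule inner_commute)+
      ultimately show ?thesis
        by (simp add: matrix_vector_right_distrib matrix_vector_mult_scaleR inner_add_left
            inner_add_right power2_eq_square distrib_left)
    qed
    ultimately show ?thesis
      by (simp add: pair_energy_def A_def B_def)
  qed
  then show thesis using that by blast
qed

section \<open>Log-homogeneity and its slices\<close>

text \<open>Up to a null set the two conditions on \<open>y\<close> describe the Pareto support. The
  constant is left open because only its independence of \<open>y\<close> matters below; for a
  Pareto density it is \<open>(d + 1) * ln t\<close>.\<close>

definition log_homogeneous :: "(real ^ 'd \<Rightarrow> real) \<Rightarrow> bool" where
  "log_homogeneous E \<longleftrightarrow> (\<forall>t\<ge>1. \<exists>c. AE y in lborel.
     (\<forall>i. 0 < y $ i) \<longrightarrow> (\<exists>i. 1 < y $ i) \<longrightarrow> E (t *\<^sub>R y) = E y + c)"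

lemma scaleR_upd: "t *\<^sub>R upd z i s = upd (t *\<^sub>R z) i (t * s)"
  by (simp add: vec_eq_iff)

text \<open>Coordinate \<open>k\<close> of the base point exceeds 1 and is not among the two that
  vary, so every point of the slice with positive \<open>u\<close> and \<open>s\<close> satisfies
  the side conditions of homogeneity.\<close>

lemma log_homogeneous_slice2:
  assumes "log_homogeneous E" "1 \<le> t" "k \<noteq> i" "k \<noteq> j"
  obtains z c where "AE u in lborel. AE s in lborel. 0 < u \<longrightarrow> 0 < s \<longrightarrow>
    E (upd (upd (t *\<^sub>R z) j (t * u)) i (t * s)) = E (upd (upd z j u) i s) + c"
proof -
  obtain c where c: "AE y in lborel. (\<forall>i. 0 < y $ i) \<longrightarrow> (\<exists>i. 1 < y $ i) \<longrightarrow> E (t *\<^sub>R y) = E y + c"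
    using assms(1,2) unfolding log_homogeneous_def by blast
  obtain z where z: "\<forall>k. 1 < z $ k \<and> z $ k < 2" and ae: "AE u in lborel. AE s in lborel.
      (\<forall>k. 0 < upd (upd z j u) i s $ k) \<longrightarrow> (\<exists>k. 1 < upd (upd z j u) i s $ k) \<longrightarrow>
      E (t *\<^sub>R upd (upd z j u) i s) = E (upd (upd z j u) i s) + c"
    using AE_lborel_vec_obtain[OF AE_lborel_upd[OF AE_lborel_upd[OF c]]] .
  have "1 < upd (upd z j u) i s $ k" for u s
    using z assms(3,4) by simp
  moreover have "0 < upd (upd z j u) i s $ k" if "0 < u" "0 < s" for u s k
    using that z less_trans[OF zero_less_one] by auto
  ultimately have step: "E (t *\<^sub>R upd (upd z j u) i s) = E (upd (upd z j u) i s) + c"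
    if "(\<forall>k. 0 < upd (upd z j u) i s $ k) \<longrightarrow> (\<exists>k. 1 < upd (upd z j u) i s $ k) \<longrightarrow>
      E (t *\<^sub>R upd (upd z j u) i s) = E (upd (upd z j u) i s) + c" "0 < u" "0 < s" for u s
    using that by metis
  show thesis
  proof (rule that[of z c], use ae in \<open>rule eventually_mono\<close>)
    fix u :: real
    assume "AE s in lborel. (\<forall>k. 0 < upd (upd z j u) i s $ k) \<longrightarrow>
      (\<exists>k. 1 < upd (upd z j u) i s $ k) \<longrightarrow>
      E (t *\<^sub>R upd (upd z j u) i s) = E (upd (upd z j u) i s) + c"
    then show "AE s in lborel. 0 < u \<longrightarrow> 0 < s \<longrightarrow>
      E (upd (upd (t *\<^sub>R z) j (t * u)) i (t * s)) = E (upd (upd z j u) i s) + c"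
      unfolding scaleR_upd[symmetric] by (rule eventually_mono) (intro impI, rule step)
  qed
qed

lemma log_homogeneous_slice:
  assumes "log_homogeneous E" "1 \<le> t" "k \<noteq> i"
  obtains z c where "AE s in lborel. 0 < s \<longrightarrow>
    E (upd (t *\<^sub>R z) i (t * s)) = E (upd z i s) + c"
proof -
  obtain c where c: "AE y in lborel. (\<forall>i. 0 < y $ i) \<longrightarrow> (\<exists>i. 1 < y $ i) \<longrightarrow> E (t *\<^sub>R y) = E y + c"
    using assms(1,2) unfolding log_homogeneous_def by blast
  obtain z where z: "\<forall>k. 1 < z $ k \<and> z $ k < 2" and ae: "AE s in lborel.
      (\<forall>k. 0 < upd z i s $ k) \<longrightarrow> (\<exists>k. 1 < upd z i s $ k) \<longrightarrow>
      E (t *\<^sub>R upd z i s) = E (upd z i s) + c"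
    using AE_lborel_vec_obtain[OF AE_lborel_upd[OF c]] .
  have "1 < upd z i s $ k" for s
    using z assms(3) by simp
  moreover have "0 < upd z i s $ k" if "0 < s" for s k
    using that z less_trans[OF zero_less_one] by auto
  ultimately have step: "E (t *\<^sub>R upd z i s) = E (upd z i s) + c"
    if "(\<forall>k. 0 < upd z i s $ k) \<longrightarrow> (\<exists>k. 1 < upd z i s $ k) \<longrightarrow>
      E (t *\<^sub>R upd z i s) = E (upd z i s) + c" "0 < s" for s
    using that by metis
  show thesis
    by (rule that[of z c], unfold scaleR_upd[symmetric], use ae in \<open>rule eventually_mono\<close>)
      (intro impI, rule step)
qed

text \<open>On the slices through \<open>z\<close> and \<open>t *\<^sub>R z\<close> the energy is a
  function of \<open>s\<close>, plus a function of \<open>u\<close>, plus the same multiple of the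
  product. Homogeneity equates the two up to a constant; dividing by
  \<open>2 * \<Theta> $ i $ j\<close> isolates the increment of the product.\<close>

lemma log_homogeneous_pair_separable:
  fixes h T :: "'d::finite \<Rightarrow> real \<Rightarrow> real"
  assumes hom: "log_homogeneous (pair_energy h T \<Theta>)" and sym: "\<Theta> \<in> symmetric_matrices"
    and "i \<noteq> j" "k \<noteq> i" "k \<noteq> j" and "\<Theta> $ i $ j \<noteq> 0" and "1 \<le> t"
  obtains a b where "AE u in lborel. AE s in lborel. 0 < u \<longrightarrow> 0 < s \<longrightarrow>
    T i (t * s) * T j (t * u) - T i s * T j u = a s + b u"
proof -
  let ?E = "pair_energy h T \<Theta>"
  obtain z c where z: "AE u in lborel. AE s in lborel. 0 < u \<longrightarrow> 0 < s \<longrightarrow>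
    ?E (upd (upd (t *\<^sub>R z) j (t * u)) i (t * s)) = ?E (upd (upd z j u) i s) + c"
    using log_homogeneous_slice2[OF hom \<open>1 \<le> t\<close> \<open>k \<noteq> i\<close> \<open>k \<noteq> j\<close>] .
  obtain A B where AB: "\<forall>s u. ?E (upd (upd z j u) i s) =
      A s + B u + 2 * \<Theta> $ i $ j * (T i s * T j u)"
    using sym \<open>i \<noteq> j\<close> by (rule pair_energy_upd)
  obtain A' B' where AB': "\<forall>s u. ?E (upd (upd (t *\<^sub>R z) j u) i s) =
      A' s + B' u + 2 * \<Theta> $ i $ j * (T i s * T j u)"
    using sym \<open>i \<noteq> j\<close> by (rule pair_energy_upd)
  let ?a = "\<lambda>s. (A s - A' (t * s) + c) / (2 * \<Theta> $ i $ j)"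
  let ?b = "\<lambda>u. (B u - B' (t * u)) / (2 * \<Theta> $ i $ j)"
  have "AE u in lborel. AE s in lborel. 0 < u \<longrightarrow> 0 < s \<longrightarrow>
    T i (t * s) * T j (t * u) - T i s * T j u = ?a s + ?b u"
    using z
  proof (rule eventually_mono, elim eventually_mono, intro impI)
    fix u s :: real
    assume "0 < u \<longrightarrow> 0 < s \<longrightarrow>
      ?E (upd (upd (t *\<^sub>R z) j (t * u)) i (t * s)) = ?E (upd (upd z j u) i s) + c" "0 < u" "0 < s"
    then have "2 * \<Theta> $ i $ j * (T i (t * s) * T j (t * u) - T i s * T j u) =
        (A s - A' (t * s) + c) + (B u - B' (t * u))"
      by (simp add: AB AB' algebra_simps)
    then show "T i (t * s) * T j (t * u) - T i s * T j u = ?a s + ?b u"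
      using \<open>\<Theta> $ i $ j \<noteq> 0\<close> by (simp add: add_divide_distrib[symmetric] eq_divide_eq mult.commute)
  qed
  then show thesis by (rule that)
qed

text \<open>If \<open>T i\<close> is almost everywhere constant, coordinate \<open>i\<close> enters
  the energy only through \<open>h i\<close>. Homogeneity on a slice then makes
  \<open>h i (2 * s) - h i s\<close> constant, so doubling \<open>y $ i\<close> alone multiplies the
  density by a fixed factor, which is incompatible with a finite integral.\<close>

lemma log_homogeneous_AE_pos_const_not_integrable:
  fixes h T :: "'d::finite \<Rightarrow> real \<Rightarrow> real" and \<Theta> :: "real ^ 'd ^ 'd"
  defines "E \<equiv> pair_energy h T \<Theta>"
  assumes hom: "log_homogeneous E" and [measurable]: "E \<in> borel_measurable borel"
    and "k \<noteq> i" and const: "AE_pos_const (T i)"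
    and int: "set_integrable lborel pareto_support (\<lambda>y. exp (- E y))"
  shows False
proof -
  obtain \<kappa> where \<kappa>: "AE s in lborel. 0 < s \<longrightarrow> T i s = \<kappa>"
    using const unfolding AE_pos_const_def by blast
  \<comment> \<open>The energy with \<open>h i\<close> removed and \<open>T i\<close> frozen at
    \<open>\<kappa>\<close>: the part that does not see coordinate \<open>i\<close>.\<close>
  define B where "B y = pair_energy (\<lambda>j s. if j = i then 0 else h j s) (\<lambda>j s. if j = i then \<kappa> else T j s) \<Theta> y" for y
  have E_eq: "E y = h i (y $ i) + B y" if "T i (y $ i) = \<kappa>" for y
  proof -
    have "(\<chi> j. if j = i then \<kappa> else T j (y $ j)) = (\<chi> j. T j (y $ j))"
      using that by (simp add: vec_eq_iff)
    moreover have "(\<Sum>j\<in>UNIV. h j (y $ j)) = h i (y $ i) + (\<Sum>j\<in>UNIV. if j = i then 0 else h j (y $ j))"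
      by (simp add: sum.If_cases sum.remove[of UNIV i] Compl_eq_Diff_UNIV)
    ultimately show ?thesis by (simp add: E_def B_def pair_energy_def)
  qed
  have B_upd: "B (upd y i s) = B y" for y s
  proof -
    have "(\<lambda>j. if j = i then 0 else h j (upd y i s $ j)) = (\<lambda>j. if j = i then 0 else h j (y $ j))"
      "(\<chi> j. if j = i then \<kappa> else T j (upd y i s $ j)) = (\<chi> j. if j = i then \<kappa> else T j (y $ j))"
      by (auto simp: vec_eq_iff)
    then show ?thesis unfolding B_def pair_energy_def by metis
  qed
  have \<kappa>2: "AE s in lborel. 0 < s \<longrightarrow> T i (2 * s) = \<kappa>"
    using AE_pos_scale[OF _ \<kappa>, of 2] by simp
  obtain z c where "AE s in lborel. 0 < s \<longrightarrow> E (upd (2 *\<^sub>R z) i (2 * s)) = E (upd z i s) + c"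
    by (rule log_homogeneous_slice[OF hom _ \<open>k \<noteq> i\<close>, of 2]) simp
  with \<kappa> \<kappa>2 have "AE s in lborel. 0 < s \<longrightarrow>
      T i s = \<kappa> \<and> T i (2 * s) = \<kappa> \<and> h i (2 * s) = h i s + (B z - B (2 *\<^sub>R z) + c)"
    by eventually_elim (auto simp: E_eq B_upd)
  from AE_lborel_nth[OF this]
  have "AE y in lborel. 0 < y $ i \<longrightarrow>
      E (upd y i (2 * y $ i)) = E y + (B z - B (2 *\<^sub>R z) + c)"
    by eventually_elim (auto simp: E_eq B_upd)
  then have "AE y in lborel. 0 < y $ i \<longrightarrow>
      exp (- E (upd y i (2 * y $ i))) = exp (- (B z - B (2 *\<^sub>R z) + c)) * exp (- E y)"
    by eventually_elim (simp add: exp_add[symmetric])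
  then have scale: "AE y in lborel. y \<in> {y. 0 < y $ i \<and> (\<forall>j. j \<noteq> i \<longrightarrow> 1 < y $ j)} \<longrightarrow>
      exp (- E (upd y i (2 * y $ i))) = exp (- (B z - B (2 *\<^sub>R z) + c)) * exp (- E y)"
    by (auto elim: eventually_mono)
  have sub: "{y. 0 < y $ i \<and> (\<forall>j. j \<noteq> i \<longrightarrow> 1 < y $ j)} \<subseteq> pareto_support"
  proof
    fix y :: "real ^ 'd" assume "y \<in> {y. 0 < y $ i \<and> (\<forall>j. j \<noteq> i \<longrightarrow> 1 < y $ j)}"
    then have y: "0 < y $ i" "\<And>j. j \<noteq> i \<Longrightarrow> 1 < y $ j" by auto
    have "0 \<le> y $ j" for j
      using y(1) y(2)[of j] by (cases "j = i") (auto intro: less_imp_le[OF less_trans[OF zero_less_one]])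
    moreover have "\<not> y $ k \<le> 1"
      using y(2)[OF \<open>k \<noteq> i\<close>] by simp
    ultimately show "y \<in> pareto_support"
      by (auto simp: pareto_support_def)
  qed
  have "(\<integral>\<^sup>+ y. ennreal (exp (- E y)) * indicator {y. 0 < y $ i \<and> (\<forall>j. j \<noteq> i \<longrightarrow> 1 < y $ j)} y \<partial>lborel)
      \<le> (\<integral>\<^sup>+ y. ennreal (norm (indicator pareto_support y *\<^sub>R exp (- E y))) \<partial>lborel)"
    using sub by (intro nn_integral_mono) (auto simp: indicator_def)
  also have "\<dots> < \<infinity>"
    using int unfolding set_integrable_def integrable_iff_bounded by simp
  finally show False
    using scale_quasi_invariant_not_integrable[OF _ _ _ scale] by simp
qed

section \<open>Zero row sums and energies affine in the logarithms\<close>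

text \<open>Subtracting the row sums \<open>r i\<close> from the diagonal makes all row sums zero;
  the squares \<open>r i * (x i)\<^sup>2\<close> restored on the right depend on one coordinate
  each, as do the linear and constant terms produced by \<open>\<beta>\<close>.\<close>

lemma quadratic_form_affine:
  fixes \<Theta> :: "real ^ 'd ^ 'd" and \<alpha> \<beta> x :: "'d \<Rightarrow> real"
  assumes "\<Theta> \<in> symmetric_matrices"
  defines "r \<equiv> \<lambda>i. \<Sum>j\<in>UNIV. \<Theta> $ i $ j * \<alpha> i * \<alpha> j"
  defines "\<Theta>' \<equiv> \<chi> i j. \<Theta> $ i $ j * \<alpha> i * \<alpha> j - (if i = j then r i else 0)"
  shows "(\<chi> i. \<alpha> i * x i + \<beta> i) \<bullet> (\<Theta> *v (\<chi> i. \<alpha> i * x i + \<beta> i)) =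
      (\<chi> i. x i) \<bullet> (\<Theta>' *v (\<chi> i. x i)) +
      (\<Sum>i\<in>UNIV. r i * (x i)\<^sup>2 + 2 * (\<Sum>j\<in>UNIV. \<Theta> $ i $ j * \<alpha> i * \<beta> j) * x i +
        (\<Sum>j\<in>UNIV. \<Theta> $ i $ j * \<beta> i * \<beta> j))"
    and "\<Theta>' \<in> zero_row_sum_symmetric_matrices"
proof -
  have sym: "\<Theta> $ i $ j = \<Theta> $ j $ i" for i j
    using assms(1) by (metis (mono_tags, lifting) mem_Collect_eq symmetric_matrices_def transpose_def vec_lambda_beta)
  \<comment> \<open>The two mixed sums agree by symmetry, which is the source of the factor 2 in the
    linear term.\<close>
  have "(\<Sum>i\<in>UNIV. \<Sum>j\<in>UNIV. \<Theta> $ i $ j * \<beta> i * (\<alpha> j * x j)) =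
      (\<Sum>i\<in>UNIV. \<Sum>j\<in>UNIV. \<Theta> $ i $ j * \<beta> j * (\<alpha> i * x i))"
    by (subst sum.swap) (simp add: sym)
  moreover have "(\<chi> i. x i) \<bullet> (\<Theta>' *v (\<chi> i. x i)) =
      (\<Sum>i\<in>UNIV. \<Sum>j\<in>UNIV. \<Theta> $ i $ j * (\<alpha> i * x i) * (\<alpha> j * x j)) - (\<Sum>i\<in>UNIV. r i * (x i)\<^sup>2)"
  proof -
    have "\<Theta>' $ i $ j * x i * x j =
        \<Theta> $ i $ j * (\<alpha> i * x i) * (\<alpha> j * x j) - (if i = j then r i * (x i)\<^sup>2 else 0)" for i j
      by (simp add: \<Theta>'_def left_diff_distrib right_diff_distrib power2_eq_square mult_ac)
    then show ?thesis
      by (simp add: quadratic_form_sum sum_subtractf)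
  qed
  ultimately show "(\<chi> i. \<alpha> i * x i + \<beta> i) \<bullet> (\<Theta> *v (\<chi> i. \<alpha> i * x i + \<beta> i)) =
      (\<chi> i. x i) \<bullet> (\<Theta>' *v (\<chi> i. x i)) +
      (\<Sum>i\<in>UNIV. r i * (x i)\<^sup>2 + 2 * (\<Sum>j\<in>UNIV. \<Theta> $ i $ j * \<alpha> i * \<beta> j) * x i +
        (\<Sum>j\<in>UNIV. \<Theta> $ i $ j * \<beta> i * \<beta> j))"
    by (simp add: quadratic_form_sum distrib_left distrib_right
        sum.distrib sum_distrib_left sum_distrib_right mult_ac)
  show "\<Theta>' \<in> zero_row_sum_symmetric_matrices"
    by (auto simp: zero_row_sum_symmetric_matrices_def symmetric_matrices_def \<Theta>'_def r_def
        transpose_def vec_eq_iff sum_subtractf sym mult_ac)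
qed

text \<open>The all-ones vector lies in the kernel of \<open>\<Theta>\<close>. Scaling
  \<open>y\<close> by \<open>t\<close> shifts \<open>log_vec y\<close> by \<open>ln t\<close> times
  this vector, so the form is scale invariant.\<close>

lemma zero_row_sum_shift_invariant:
  assumes "\<Theta> \<in> zero_row_sum_symmetric_matrices"
  shows "(x + c *\<^sub>R 1) \<bullet> (\<Theta> *v (x + c *\<^sub>R 1)) = x \<bullet> (\<Theta> *v x)"
proof -
  have "\<Theta> *v 1 = 0"
    using assms by (simp add: zero_row_sum_symmetric_matrices_def vec_eq_iff matrix_vector_mult_def)
  moreover have "1 \<bullet> (\<Theta> *v x) = (\<Theta> *v 1) \<bullet> x"
    using assms by (intro symmetric_matrices_inner) (simp add: zero_row_sum_symmetric_matrices_def)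
  ultimately show ?thesis
    by (simp add: matrix_vector_right_distrib matrix_vector_mult_scaleR inner_add_left)
qed

text \<open>The energy splits into a scale-invariant form in \<open>log_vec y\<close> and a sum
  \<open>D\<close> of functions of single coordinates. So \<open>D\<close> inherits homogeneity, and
  varying one coordinate shows that each summand has constant scale increments, hence is affine in
  \<open>ln\<close>.\<close>

lemma log_homogeneous_affine_ln_energy:
  fixes h T :: "'d::finite \<Rightarrow> real \<Rightarrow> real" and \<Theta> :: "real ^ 'd ^ 'd"
  assumes card: "CARD('d) \<ge> 3"
    and hom: "log_homogeneous (pair_energy h T \<Theta>)" and sym: "\<Theta> \<in> symmetric_matrices"
    and h [measurable]: "\<And>i. h i \<in> borel_measurable borel"
    and T: "\<And>i. AE s in lborel. 0 < s \<longrightarrow> T i s = \<alpha> i * ln s + \<beta> i"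
  obtains \<nu> \<mu>' \<Theta>' where "\<Theta>' \<in> zero_row_sum_symmetric_matrices"
    "AE y in lborel. (\<forall>i. 0 < y $ i) \<longrightarrow>
       pair_energy h T \<Theta> y = \<nu> + \<mu>' \<bullet> log_vec y + log_vec y \<bullet> (\<Theta>' *v log_vec y)"
proof -
  let ?E = "pair_energy h T \<Theta>"
  define r where "r i = (\<Sum>j\<in>UNIV. \<Theta> $ i $ j * \<alpha> i * \<alpha> j)" for i
  define \<Theta>' where "\<Theta>' = (\<chi> i j. \<Theta> $ i $ j * \<alpha> i * \<alpha> j - (if i = j then r i else 0))"
  \<comment> \<open>\<open>m i\<close> joins to \<open>h i\<close> every term of the expanded
    quadratic form that involves coordinate \<open>i\<close> alone.\<close>
  define m where "m i s = h i s + (r i * (ln s)\<^sup>2 +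
      2 * (\<Sum>j\<in>UNIV. \<Theta> $ i $ j * \<alpha> i * \<beta> j) * ln s + (\<Sum>j\<in>UNIV. \<Theta> $ i $ j * \<beta> i * \<beta> j))" for i s
  define D where "D y = (\<Sum>i\<in>UNIV. m i (y $ i))" for y :: "real ^ 'd"
  have \<Theta>': "\<Theta>' \<in> zero_row_sum_symmetric_matrices"
    unfolding \<Theta>'_def r_def by (rule quadratic_form_affine(2)[OF sym])
  have [measurable]: "m i \<in> borel_measurable borel" for i
    unfolding m_def by measurable
  have "AE y in lborel. 0 < y $ i \<longrightarrow> T i (y $ i) = \<alpha> i * ln (y $ i) + \<beta> i" for i
    using AE_lborel_nth[OF T] .
  then have "AE y in lborel. \<forall>i. 0 < y $ i \<longrightarrow> T i (y $ i) = \<alpha> i * ln (y $ i) + \<beta> i"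
    by (rule eventually_all_finite)
  then have E_D: "AE y in lborel. (\<forall>i. 0 < y $ i) \<longrightarrow>
      ?E y = D y + log_vec y \<bullet> (\<Theta>' *v log_vec y)"
  proof (rule eventually_mono, intro impI)
    fix y :: "real ^ 'd"
    assume "\<forall>i. 0 < y $ i \<longrightarrow> T i (y $ i) = \<alpha> i * ln (y $ i) + \<beta> i" "\<forall>i. 0 < y $ i"
    then have "(\<chi> i. T i (y $ i)) = (\<chi> i. \<alpha> i * ln (y $ i) + \<beta> i)"
      by (simp add: vec_eq_iff)
    then show "?E y = D y + log_vec y \<bullet> (\<Theta>' *v log_vec y)"
      using quadratic_form_affine(1)[OF sym, of \<alpha> "\<lambda>i. ln (y $ i)" \<beta>]
      by (simp add: pair_energy_def log_vec_def D_def m_def sum.distrib \<Theta>'_def r_def cong: if_cong)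
  qed
  have "log_homogeneous D"
    unfolding log_homogeneous_def
  proof (intro allI impI)
    fix t :: real assume t: "1 \<le> t"
    obtain c where c: "AE y in lborel. (\<forall>i. 0 < y $ i) \<longrightarrow> (\<exists>i. 1 < y $ i) \<longrightarrow> ?E (t *\<^sub>R y) = ?E y + c"
      using hom t unfolding log_homogeneous_def by blast
    have "AE y in lborel. (\<forall>i. 0 < (t *\<^sub>R y) $ i) \<longrightarrow>
        ?E (t *\<^sub>R y) = D (t *\<^sub>R y) + log_vec (t *\<^sub>R y) \<bullet> (\<Theta>' *v log_vec (t *\<^sub>R y))"
      by (rule AE_lborel_linear[OF _ _ E_D, of "\<lambda>x. x /\<^sub>R t"]) (use t in auto)
    with c E_D have "AE y in lborel. (\<forall>i. 0 < y $ i) \<longrightarrow> (\<exists>i. 1 < y $ i) \<longrightarrow> D (t *\<^sub>R y) = D y + c"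
    proof eventually_elim
      case (elim y)
      show ?case
      proof (intro impI)
        assume pos: "\<forall>i. 0 < y $ i" and "\<exists>i. 1 < y $ i"
        have pos': "\<forall>i. 0 < (t *\<^sub>R y) $ i" using pos t by simp
        have "log_vec (t *\<^sub>R y) = log_vec y + ln t *\<^sub>R 1"
          using pos t by (simp add: vec_eq_iff log_vec_def ln_mult_pos)
        then show "D (t *\<^sub>R y) = D y + c"
          using elim(1,2)[rule_format, OF pos[rule_format]] elim(3)[rule_format, OF pos'[rule_format]]
            \<open>\<exists>i. 1 < y $ i\<close> zero_row_sum_shift_invariant[OF \<Theta>', of "log_vec y" "ln t"]
          by auto
      qed
    qed
    then show "\<exists>c. AE y in lborel. (\<forall>i. 0 < y $ i) \<longrightarrow> (\<exists>i. 1 < y $ i) \<longrightarrow> D (t *\<^sub>R y) = D y + c" ..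
  qed
  have "\<exists>c. AE s in lborel. 0 < s \<longrightarrow> m i (t * s) = m i s + c" if t: "1 \<le> t" for i t
  proof -
    obtain k :: 'd where "k \<noteq> i" using third_index[OF card] by blast
    obtain z c where z: "AE s in lborel. 0 < s \<longrightarrow> D (upd (t *\<^sub>R z) i (t * s)) = D (upd z i s) + c"
      by (rule log_homogeneous_slice[OF \<open>log_homogeneous D\<close> t \<open>k \<noteq> i\<close>])
    have "D (upd z i s) = m i s + (\<Sum>k\<in>UNIV - {i}. m k (z $ k))" for z s
      unfolding D_def by (subst sum.remove[of UNIV i]) auto
    with z have "AE s in lborel. 0 < s \<longrightarrow> m i (t * s) = m i s +
        ((\<Sum>k\<in>UNIV - {i}. m k (z $ k)) - (\<Sum>k\<in>UNIV - {i}. m k ((t *\<^sub>R z) $ k)) + c)"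
      by (auto elim!: eventually_mono)
    then show ?thesis ..
  qed
  then have "\<exists>a b. AE s in lborel. 0 < s \<longrightarrow> m i s = a * ln s + b" for i
    using AE_scale_increment_imp_affine_ln[of "m i"] by (metis \<open>\<And>i. m i \<in> borel_measurable borel\<close>)
  then obtain a b where ab: "\<And>i. AE s in lborel. 0 < s \<longrightarrow> m i s = a i * ln s + b i"
    by metis
  have "AE y in lborel. 0 < y $ i \<longrightarrow> m i (y $ i) = a i * ln (y $ i) + b i" for i
    using AE_lborel_nth[OF ab] .
  then have "AE y in lborel. \<forall>i. 0 < y $ i \<longrightarrow> m i (y $ i) = a i * ln (y $ i) + b i"
    by (rule eventually_all_finite)
  with E_D have "AE y in lborel. (\<forall>i. 0 < y $ i) \<longrightarrow>
      ?E y = sum b UNIV + (\<chi> i. a i) \<bullet> log_vec y + log_vec y \<bullet> (\<Theta>' *v log_vec y)"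
    by eventually_elim (simp add: D_def sum.distrib inner_vec_def log_vec_def)
  with \<Theta>' show thesis by (rule that)
qed

section \<open>From Pareto densities to energies and back to the generalized class\<close>

lemma pareto_support_pos_iff:
  assumes "\<forall>i. 0 < y $ i"
  shows "y \<in> pareto_support \<longleftrightarrow> (\<exists>i. 1 < y $ i)"
  using assms by (auto simp: pareto_support_def less_imp_le not_le)

lemma AE_pareto_support_pos: "AE y in lborel. y \<in> pareto_support \<longrightarrow> (\<forall>i. 0 < y $ i)"
proof -
  have "AE y in lborel. \<forall>i. (y :: real ^ 'd) $ i \<noteq> 0"
    by (intro eventually_all_finite AE_lborel_nth AE_lborel_singleton)
  then show ?thesis
    by (rule eventually_mono) (auto simp: pareto_support_def order_less_le)
qed

text \<open>Exact homogeneity holds for some version \<open>f\<close> of the density only. For each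
  fixed \<open>t\<close>, both \<open>g y = f y\<close> and
  \<open>g (t *\<^sub>R y) = f (t *\<^sub>R y)\<close> hold almost everywhere, and taking logarithms
  transfers the relation to \<open>E\<close>.\<close>

lemma multivariate_pareto_log_homogeneous:
  fixes E :: "real ^ 'd \<Rightarrow> real"
  assumes g: "\<And>y. g y = (if y \<in> pareto_support then C * exp (- E y) else 0)"
    and [measurable]: "g \<in> borel_measurable borel" and "0 < C"
    and pareto: "multivariate_pareto (density lborel (\<lambda>y. ennreal (g y)))"
  shows "log_homogeneous E"
proof -
  obtain f :: "real ^ 'd \<Rightarrow> real" where f [measurable]: "f \<in> borel_measurable borel"
    and f_nonneg: "\<forall>y. 0 \<le> f y"
    and dens: "density lborel (\<lambda>y. ennreal (g y)) = density lborel (\<lambda>y. ennreal (f y))"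
    and scale: "\<forall>y\<in>pareto_support. \<forall>t\<ge>1. f (t *\<^sub>R y) = f y / t ^ (CARD('d) + 1)"
    using pareto unfolding multivariate_pareto_def by blast
  have "AE y in lborel. ennreal (g y) = ennreal (f y)"
    using dens by (intro sigma_finite_measure.density_unique[OF sigma_finite_lborel]) auto
  then have g_f: "AE y in lborel. g y = f y"
    by (rule eventually_mono) (use f_nonneg \<open>0 < C\<close> in \<open>auto simp: g\<close>)
  show ?thesis
    unfolding log_homogeneous_def
  proof (intro allI impI exI)
    fix t :: real assume t: "1 \<le> t"
    have "AE y in lborel. g (t *\<^sub>R y) = f (t *\<^sub>R y)"
      by (rule AE_lborel_linear[OF _ _ g_f, of "\<lambda>x. x /\<^sub>R t"]) (use t in auto)
    with g_f show "AE y in lborel. (\<forall>i. 0 < y $ i) \<longrightarrow> (\<exists>i. 1 < y $ i) \<longrightarrow>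
        E (t *\<^sub>R y) = E y + real (CARD('d) + 1) * ln t"
    proof eventually_elim
      case (elim y)
      show ?case
      proof (intro impI)
        assume pos: "\<forall>i. 0 < y $ i" and "\<exists>i. 1 < y $ i"
        then obtain i where i: "1 < y $ i" by blast
        have y: "y \<in> pareto_support"
          using pos i pareto_support_pos_iff by blast
        have "1 * y $ i \<le> t * y $ i"
          using t i by (intro mult_right_mono) linarith+
        then have "1 < t * y $ i"
          using i by linarith
        moreover have "\<forall>i. 0 < (t *\<^sub>R y) $ i"
          using pos t by simp
        ultimately have ty: "t *\<^sub>R y \<in> pareto_support"
          using pareto_support_pos_iff[of "t *\<^sub>R y"] by auto
        have "C * exp (- E (t *\<^sub>R y)) = C * exp (- E y) / t ^ (CARD('d) + 1)"
          using elim scale y ty t by (simp add: g)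
        also have "t ^ (CARD('d) + 1) = exp (real (CARD('d) + 1) * ln t)"
          using t by (subst exp_of_nat_mult) auto
        finally have "C * exp (- E (t *\<^sub>R y)) = C * exp (- E y - real (CARD('d) + 1) * ln t)"
          by (simp add: exp_diff)
        then have "exp (- E (t *\<^sub>R y)) = exp (- E y - real (CARD('d) + 1) * ln t)"
          using \<open>0 < C\<close> by (subst (asm) mult_cancel_left) simp
        then show "E (t *\<^sub>R y) = E y + real (CARD('d) + 1) * ln t"
          by simp
      qed
    qed
  qed
qed

lemma gen_HR_kernel_measurable [measurable]: "gen_HR_kernel \<mu> \<Theta> \<in> borel_measurable borel"
  unfolding gen_HR_kernel_def quadratic_form_sum unfolding inner_vec_def log_vec_def vec_lambda_beta
  by measurable

lemma pi_kernel_measurable: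
  fixes S :: "'d::finite \<Rightarrow> real \<Rightarrow> real ^ 'q"
  assumes [measurable]: "\<And>i. S i \<in> borel_measurable borel" "\<And>i. T i \<in> borel_measurable borel"
  shows "pi_kernel S T \<mu> \<Theta> \<in> borel_measurable borel"
  unfolding pi_kernel_def by measurable

text \<open>Normalizing cancels the factor \<open>C\<close>. Integrability passes from
  \<open>k\<close> to the proportional kernel, so \<open>gen_HR_normalizer\<close> is the actual
  integral and not its default value 1.\<close>

lemma proportional_gen_HR:
  fixes k :: "real ^ 'd \<Rightarrow> real"
  assumes [measurable]: "pareto_support \<in> sets (borel :: (real ^ 'd) measure)" "k \<in> borel_measurable borel"
    and int: "set_integrable lborel pareto_support k"
    and \<Theta>: "\<Theta> \<in> zero_row_sum_symmetric_matrices"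
    and k: "AE y in lborel. y \<in> pareto_support \<longrightarrow> gen_HR_kernel \<mu> \<Theta> y = C * k y" and "C \<noteq> 0"
  shows "\<exists>g\<in>gen_HR. AE y in lborel. y \<in> pareto_support \<longrightarrow>
    1 / set_lebesgue_integral lborel pareto_support k * k y = g y"
proof -
  have int': "set_integrable lborel pareto_support (\<lambda>y. C * k y)"
    using int by simp
  have "set_integrable lborel pareto_support (gen_HR_kernel \<mu> \<Theta>)"
    using int' by (subst set_integrable_cong_AE[of _ _ "\<lambda>y. C * k y"]) (use k in auto)
  moreover have "set_lebesgue_integral lborel pareto_support (gen_HR_kernel \<mu> \<Theta>) =
      set_lebesgue_integral lborel pareto_support (\<lambda>y. C * k y)"
    by (rule set_lebesgue_integral_cong_AE) (use k in auto)
  ultimately have "gen_HR_normalizer \<mu> \<Theta> = C * set_lebesgue_integral lborel pareto_support k"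
    by (simp add: gen_HR_normalizer_def)
  then have "AE y in lborel. y \<in> pareto_support \<longrightarrow>
    1 / set_lebesgue_integral lborel pareto_support k * k y =
    1 / gen_HR_normalizer \<mu> \<Theta> * gen_HR_kernel \<mu> \<Theta> y"
    using k \<open>C \<noteq> 0\<close> by (auto elim!: eventually_mono)
  moreover have "(\<lambda>y. 1 / gen_HR_normalizer \<mu> \<Theta> * gen_HR_kernel \<mu> \<Theta> y) \<in> gen_HR"
    using \<Theta> unfolding gen_HR_def by blast
  ultimately show ?thesis by (rule bexI)
qed

section \<open>The inclusion of the density classes\<close>

theorem lemma1:
  fixes \<P> :: "(real ^ 'd) measure set"
    and \<F> :: "(real ^ 'd \<Rightarrow> real) set"
    and \<Omega> :: "(((real ^ 'q) ^ 'd) \<times> (real ^ 'd ^ 'd)) set"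
    and S :: "'d \<Rightarrow> real \<Rightarrow> real ^ 'q"
    and T :: "'d \<Rightarrow> real \<Rightarrow> real"
  assumes "CARD('d) \<ge> 3"
    and "\<forall>M\<in>\<P>. multivariate_pareto M"
    and "pairwise_interaction_model pareto_support \<Omega> S T \<P>"
    and "\<F> = pi_densities pareto_support \<Omega> S T"
  shows "ae_subclass_on pareto_support \<F> gen_HR"
proof -
  let ?L = "pareto_support :: (real ^ 'd) set"
  let ?h = "\<lambda>\<mu> i s. \<mu> $ i \<bullet> S i s"
  note card = assms(1)
  have L [measurable]: "?L \<in> sets borel"
    and S [measurable]: "\<And>i. S i \<in> borel_measurable borel"
    and T [measurable]: "\<And>i. T i \<in> borel_measurable borel"
    and \<P>: "\<P> = (\<lambda>f. density lborel (\<lambda>y. ennreal (f y))) ` pi_densities ?L \<Omega> S T"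
    and interact: "\<And>i j. i \<noteq> j \<Longrightarrow> \<exists>(\<mu>, \<Theta>)\<in>\<Omega>. \<Theta> $ i $ j \<noteq> 0"
    and sym: "\<And>\<mu> \<Theta>. (\<mu>, \<Theta>) \<in> \<Omega> \<Longrightarrow> \<Theta> \<in> symmetric_matrices"
    and int: "\<And>\<mu> \<Theta>. (\<mu>, \<Theta>) \<in> \<Omega> \<Longrightarrow> set_integrable lborel ?L (pi_kernel S T \<mu> \<Theta>)"
    and Z: "\<And>\<mu> \<Theta>. (\<mu>, \<Theta>) \<in> \<Omega> \<Longrightarrow> 0 < pi_normalizer ?L S T \<mu> \<Theta>"
    using assms(3) unfolding pairwise_interaction_model_def by auto
  have kernel [measurable]: "pi_kernel S T \<mu> \<Theta> \<in> borel_measurable borel" for \<mu> \<Theta>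
    by (rule pi_kernel_measurable[OF S T])
  have hom: "log_homogeneous (pair_energy (?h \<mu>) T \<Theta>)" if \<Omega>: "(\<mu>, \<Theta>) \<in> \<Omega>" for \<mu> \<Theta>
  proof (rule multivariate_pareto_log_homogeneous)
    show "pi_density ?L S T \<mu> \<Theta> y = (if y \<in> ?L then
        1 / pi_normalizer ?L S T \<mu> \<Theta> * exp (- pair_energy (?h \<mu>) T \<Theta> y) else 0)" for y
      by (simp add: pi_density_def pi_kernel_energy)
    show "pi_density ?L S T \<mu> \<Theta> \<in> borel_measurable borel"
      unfolding pi_density_def by measurable
    show "0 < 1 / pi_normalizer ?L S T \<mu> \<Theta>"
      using Z[OF \<Omega>] by simp
    show "multivariate_pareto (density lborel (\<lambda>y. ennreal (pi_density ?L S T \<mu> \<Theta> y)))"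
      using \<Omega> assms(2) unfolding \<P> pi_densities_def by blast
  qed
  have T_nonconst: "\<not> AE_pos_const (T i)" for i
  proof
    assume const: "AE_pos_const (T i)"
    obtain k :: 'd where k: "k \<noteq> i" using third_index[OF card] by blast
    obtain \<mu> \<Theta> where \<Omega>: "(\<mu>, \<Theta>) \<in> \<Omega>" using interact[OF k] by blast
    have eq: "pi_kernel S T \<mu> \<Theta> = (\<lambda>y. exp (- pair_energy (?h \<mu>) T \<Theta> y))"
      by (simp add: fun_eq_iff pi_kernel_energy)
    have "(\<lambda>y. - ln (pi_kernel S T \<mu> \<Theta> y)) \<in> borel_measurable borel" by measurable
    then have "pair_energy (?h \<mu>) T \<Theta> \<in> borel_measurable borel"
      by (simp add: eq)
    then show False
      using log_homogeneous_AE_pos_const_not_integrable[OF hom[OF \<Omega>] _ k const] int[OF \<Omega>]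
      by (simp add: eq)
  qed
  have "\<exists>c e e'. c \<noteq> 0 \<and> (AE s in lborel. 0 < s \<longrightarrow> T i (t * s) = c * T i s + e) \<and>
      (AE s in lborel. 0 < s \<longrightarrow> T j (t * s) = inverse c * T j s + e')"
    if "i \<noteq> j" "1 \<le> t" for i j t
  proof -
    \<comment> \<open>Different pairs may require different parameters, but the conclusion concerns
      only the functions \<open>T\<close>, which all parameters share; the rates from several pairs
      can therefore be combined.\<close>
    obtain \<mu> \<Theta> where \<Omega>: "(\<mu>, \<Theta>) \<in> \<Omega>" "\<Theta> $ i $ j \<noteq> 0" using interact[OF \<open>i \<noteq> j\<close>] by blast
    obtain k :: 'd where k: "k \<noteq> i" "k \<noteq> j" using third_index[OF card] by blast
    obtain a b where ab: "AE u in lborel. AE s in lborel. 0 < u \<longrightarrow> 0 < s \<longrightarrow>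
        T i (t * s) * T j (t * u) - T i s * T j u = a s + b u"
      by (rule log_homogeneous_pair_separable[OF hom[OF \<Omega>(1)] sym[OF \<Omega>(1)] \<open>i \<noteq> j\<close> k \<Omega>(2) \<open>1 \<le> t\<close>])
    have "0 < t" using \<open>1 \<le> t\<close> by simp
    obtain c e e' where "c \<noteq> 0" "AE s in lborel. 0 < s \<longrightarrow> T i (t * s) = c * T i s + e"
      "AE s in lborel. 0 < s \<longrightarrow> T j (t * s) = inverse c * T j s + e'"
      by (rule AE_product_increment_separable[OF \<open>0 < t\<close> T_nonconst T_nonconst ab])
    then show ?thesis by blast
  qed
  note rates = AE_scale_rates_trivial[of T, OF card T_nonconst this]
  have "\<exists>a b. AE s in lborel. 0 < s \<longrightarrow> T i s = a * ln s + b" for i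
    by (rule AE_scale_increment_imp_affine_ln[OF T rates]) blast+
  then obtain \<alpha> \<beta> where \<alpha>\<beta>: "\<And>i. AE s in lborel. 0 < s \<longrightarrow> T i s = \<alpha> i * ln s + \<beta> i"
    by metis
  show ?thesis
    unfolding ae_subclass_on_def
  proof
    fix f assume "f \<in> \<F>"
    then obtain \<mu> \<Theta> where \<Omega>: "(\<mu>, \<Theta>) \<in> \<Omega>" and f: "f = pi_density ?L S T \<mu> \<Theta>"
      unfolding assms(4) pi_densities_def by blast
    have h: "?h \<mu> i \<in> borel_measurable borel" for i by measurable
    obtain \<nu> \<mu>' \<Theta>' where \<Theta>': "\<Theta>' \<in> zero_row_sum_symmetric_matrices"
      and energy: "AE y in lborel. (\<forall>i. 0 < y $ i) \<longrightarrow> pair_energy (?h \<mu>) T \<Theta> y =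
        \<nu> + \<mu>' \<bullet> log_vec y + log_vec y \<bullet> (\<Theta>' *v log_vec y)"
      by (rule log_homogeneous_affine_ln_energy[OF card hom[OF \<Omega>] sym[OF \<Omega>] h \<alpha>\<beta>])
    \<comment> \<open>The constant \<open>\<nu>\<close> of the energy becomes the factor
      \<open>exp \<nu>\<close>, which the normalization absorbs.\<close>
    have "AE y in lborel. y \<in> ?L \<longrightarrow> gen_HR_kernel \<mu>' \<Theta>' y = exp \<nu> * pi_kernel S T \<mu> \<Theta> y"
      using energy AE_pareto_support_pos
      by eventually_elim (simp add: gen_HR_kernel_def pi_kernel_energy exp_add[symmetric])
    from proportional_gen_HR[OF L kernel int[OF \<Omega>] \<Theta>' this]
    show "\<exists>g\<in>gen_HR. AE y in lborel. y \<in> ?L \<longrightarrow> f y = g y"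
      by (auto simp: f pi_density_def pi_normalizer_def)
  qed
qed

end
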